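(* Let $(u,v,w)\in\{0,1,2\}^3$. Then the following hold, as subsets of the Gromov--Hausdorff space $(\mathcal{M},d_{GH})$: (1) if $\{u,v,w\}\setminus\{2\}=\{1\}$, then $\mathcal{X}(u,v,w)$ is dense and $F_\sigma$; (2) if $\{u,v,w\}\setminus\{2\}=\{0\}$, then $\mathcal{X}(u,v,w)$ is dense and $G_\delta$; (3) if $\{u,v,w\}\setminus\{2\}=\{0,1\}$, then $\mathcal{X}(u,v,w)$ is dense, $F_{\sigma\delta}$ and $G_{\delta\sigma}$.
   Context: $\mathcal{M}$ is the set of all isometry classes of non-empty compact metric spaces, equipped with the Gromov--Hausdorff distance $d_{GH}$. $B(x,r)$ denotes the closed ball and $\delta_d(X)$ the diameter. A metric space $(X,d)$ is $N$-doubling ($N\in\mathbb{N}$) if for all $x\in X$, $r\in(0,\infty)$ there is $F\subset X$ with $B(x,r)\subset\bigcup_{y\in F}B(y,r/2)$ and $\mathrm{Card}(F)\le N$; it is doubling if it is $N$-doubling for some $N$. It is $\delta$-uniformly disconnected ($\delta\in(0,\infty)$) if for every non-constant finite sequence $\{z_i\}_{i=1}^N$ in $X$ we have $\delta d(z_1,z_N)\le\max_{1\le i\le N-1}d(z_i,z_{i+1})$; it is uniformly disconnected if this holds for some $\delta\in(0,\infty)$. It is $c$-uniformly perfect ($c\in(0,1)$) if for every $x\in X$ and every $r\in(0,\delta_d(X))$ there is $y\in X$ with $c\cdot r\le d(x,y)\le r$; it is uniformly perfect if this holds for some $c\in(0,1)$. Let $\mathcal{Q}_1,\mathcal{Q}_2,\mathcal{Q}_3\subset\mathcal{M}$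 be the sets of all doubling, all uniformly disconnected, and all uniformly perfect spaces, respectively. For $k\in\{1,2,3\}$ put $\mathcal{E}_k(0)=\mathcal{M}\setminus\mathcal{Q}_k$, $\mathcal{E}_k(1)=\mathcal{Q}_k$, $\mathcal{E}_k(2)=\mathcal{M}$, and $\mathcal{X}(u,v,w)=\mathcal{E}_1(u)\cap\mathcal{E}_2(v)\cap\mathcal{E}_3(w)$. $F_\sigma$: countable union of closed sets; $G_\delta$: countable intersection of open sets; $F_{\sigma\delta}$: countable intersection of $F_\sigma$ sets; $G_{\delta\sigma}$: countable union of $G_\delta$ sets. *)

theory Defs
  imports "HOL-Analysis.Analysis"
begin

definition isometric_embedding :: "'a metric \<Rightarrow> 'b metric \<Rightarrow> ('a \<Rightarrow> 'b) \<Rightarrow> bool" where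
  "isometric_embedding X Y f \<longleftrightarrow>
     f \<in> mspace X \<rightarrow> mspace Y \<and>
     (\<forall>x\<in>mspace X. \<forall>y\<in>mspace X. mdist Y (f x) (f y) = mdist X x y)"

definition isometric :: "'a metric \<Rightarrow> 'b metric \<Rightarrow> bool" where
  "isometric X Y \<longleftrightarrow> (\<exists>f. isometric_embedding X Y f \<and> f ` mspace X = mspace Y)"

definition nonempty_compact_metric :: "'a metric \<Rightarrow> bool" where
  "nonempty_compact_metric X \<longleftrightarrow> mspace X \<noteq> {} \<and> compact_space (mtopology_of X)"

lemma isometric_embedding_id: "isometric_embedding X X id"
  by (simp add: isometric_embedding_def)

lemma isometric_embedding_comp:
  "\<lbrakk>isometric_embedding X Y f; isometric_embedding Y Z g\<rbrakk> \<Longrightarrow> isometric_embedding X Z (g \<circ> f)"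
  by (auto simp: isometric_embedding_def Pi_iff)

lemma isometric_embedding_inj_on:
  assumes "isometric_embedding X Y f" shows "inj_on f (mspace X)"
proof (rule inj_onI)
  fix x y assume xy: "x \<in> mspace X" "y \<in> mspace X" "f x = f y"
  then have "mdist X x y = mdist Y (f x) (f x)" "f x \<in> mspace Y"
    using assms unfolding isometric_embedding_def by (metis, blast)
  then have "mdist X x y = 0"
    by simp
  then show "x = y"
    using xy by simp
qed

lemma isometric_refl: "isometric X X"
  unfolding isometric_def using isometric_embedding_id[of X] by (metis image_id id_apply)

lemma isometric_trans:
  assumes "isometric X Y" "isometric Y Z" shows "isometric X Z"
proof -
  obtain f g where "isometric_embedding X Y f" "f ` mspace X = mspace Y"
    "isometric_embedding Y Z g" "g ` mspace Y = mspace Z"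
    using assms by (auto simp: isometric_def)
  then show ?thesis
    unfolding isometric_def by (intro exI[of _ "g \<circ> f"]) (metis isometric_embedding_comp image_comp)
qed

lemma isometricE:
  assumes "isometric X Y"
  obtains f g where "isometric_embedding X Y f" "isometric_embedding Y X g"
    "f ` mspace X = mspace Y" "g ` mspace Y = mspace X"
    "\<And>x. x \<in> mspace X \<Longrightarrow> g (f x) = x" "\<And>y. y \<in> mspace Y \<Longrightarrow> f (g y) = y"
proof -
  obtain f where f: "isometric_embedding X Y f" "f ` mspace X = mspace Y"
    using assms by (auto simp: isometric_def)
  define g where "g = inv_into (mspace X) f"
  have inj: "inj_on f (mspace X)"
    using f(1) by (rule isometric_embedding_inj_on)
  have gY: "g y \<in> mspace X" "f (g y) = y" if "y \<in> mspace Y" for y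
    using that f(2) by (auto simp: g_def inv_into_into f_inv_into_f)
  have gX: "g (f x) = x" if "x \<in> mspace X" for x
    using that inj by (simp add: g_def)
  have "mdist X (g y) (g z) = mdist Y y z" if "y \<in> mspace Y" "z \<in> mspace Y" for y z
    using f(1) gY[OF that(1)] gY[OF that(2)] by (metis isometric_embedding_def)
  then have "isometric_embedding Y X g"
    using gY by (auto simp: isometric_embedding_def)
  moreover have "g ` mspace Y = mspace X"
    using inj f(2) by (metis g_def inv_into_image_cancel order_refl)
  ultimately show ?thesis
    using f gX gY that by blast
qed

lemma isometric_sym: "isometric X Y \<Longrightarrow> isometric Y X"
  by (metis isometricE isometric_def)

text \<open>
  A compact metric space has at most the cardinality of the continuum, so every nonempty compact
  metric space is isometric to one whose carrier is a set of reals.  Hence the isometry classes of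
  nonempty compact metric spaces form a type that can be obtained as a quotient of
  \<^typ>\<open>real metric\<close>; no restriction is put on the metrics, which need not be related to the usual
  distance of the reals.
\<close>

lemma nonempty_compact_metric_isometric_real:
  fixes X :: "'a metric"
  assumes "nonempty_compact_metric X"
  shows "\<exists>Y::real metric. isometric X Y"
proof -
  interpret M: Metric_space "mspace X" "mdist X"
    by simp
  have "M.mtotally_bounded (mspace X)"
    using assms by (simp add: nonempty_compact_metric_def mtopology_of_def
        M.compact_space_eq_mcomplete_mtotally_bounded)
  then have "\<forall>n. \<exists>K. finite K \<and> K \<subseteq> mspace X \<and> mspace X \<subseteq> (\<Union>x\<in>K. M.mball x (1 / real (Suc n)))"
    unfolding M.mtotally_bounded_def by simp
  then obtain K where K: "\<And>n. finite (K n)" "\<And>n. K n \<subseteq> mspace X"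
    "\<And>n. mspace X \<subseteq> (\<Union>x\<in>K n. M.mball x (1 / real (Suc n)))"
    by metis
  define q where "q = from_nat_into (\<Union>n. K n)"
  have q: "\<exists>i. q i = a" if "a \<in> K n" for a n
    unfolding q_def
    by (metis K(1) UNIV_I UN_I countable_UN countable_finite countableI_type from_nat_into_surj that)
  define \<phi> where "\<phi> x = {prod_encode (i, j) | i j. mdist X (q i) x < 1 / real (Suc j)}" for x
  have \<phi>_iff: "prod_encode (i, j) \<in> \<phi> x \<longleftrightarrow> mdist X (q i) x < 1 / real (Suc j)" for i j x
    by (auto simp: \<phi>_def)
  have "inj_on \<phi> (mspace X)"
  proof (rule inj_onI, rule ccontr)
    fix x y assume xy: "x \<in> mspace X" "y \<in> mspace X" "\<phi> x = \<phi> y" "x \<noteq> y"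
    then have "mdist X x y / 2 > 0"
      by simp
    then obtain j where j: "1 / real (Suc j) < mdist X x y / 2"
      using nat_approx_posE by blast
    obtain a where a: "a \<in> K j" "x \<in> M.mball a (1 / real (Suc j))"
      using K(3)[of j] xy(1) by blast
    obtain i where i: "q i = a"
      using q a(1) by blast
    then have "mdist X a x < 1 / real (Suc j)" "mdist X a y < 1 / real (Suc j)"
      using a(2) \<phi>_iff xy(3) by (auto, metis)
    moreover have "mdist X x y \<le> mdist X a x + mdist X a y"
      using mdist_triangle[of x X a y] xy a K(2) by (metis in_mono mdist_commute)
    ultimately show False
      using j by linarith
  qed
  then have "mspace X \<lesssim> (UNIV::nat set set)"
    by (auto simp: lepoll_def)
  also have "\<dots> \<lesssim> (UNIV::real set)"
    by (simp add: eqpoll_imp_lepoll nat_sets_eqpoll_reals)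
  finally have "mspace X \<lesssim> (UNIV::real set)" .
  then obtain f :: "'a \<Rightarrow> real" where f: "inj_on f (mspace X)"
    by (auto simp: lepoll_def)
  define g where "g = inv_into (mspace X) f"
  have gf: "g (f x) = x" if "x \<in> mspace X" for x
    using f that by (simp add: g_def)
  interpret S: Metric_space "f ` mspace X" "\<lambda>a b. if a \<in> f ` mspace X \<and> b \<in> f ` mspace X then mdist X (g a) (g b) else 0"
    by unfold_locales (auto simp: gf mdist_commute mdist_triangle)
  have "isometric X S.Self"
    unfolding isometric_def isometric_embedding_def S.mspace_Self S.mdist_Self
    by (intro exI[of _ f]) (auto simp: gf)
  then show ?thesis
    by blast
qed

lemma isometric_nonempty_compact_metric:
  assumes "isometric X Y" "nonempty_compact_metric X" shows "nonempty_compact_metric Y"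
proof -
  obtain f where f: "isometric_embedding X Y f" "f ` mspace X = mspace Y"
    using assms by (auto simp: isometric_def)
  have "homeomorphic_map (mtopology_of X) (mtopology_of Y) f"
    unfolding mtopology_of_def
    using Metric_space12.isometry_imp_homeomorphic_map[OF Metric_space12_mspace_mdist f(2)] f(1)
    by (simp add: isometric_embedding_def)
  then have "mtopology_of X homeomorphic_space mtopology_of Y"
    by (metis homeomorphic_map_imp_homeomorphic_space)
  then show ?thesis
    using assms(2) f(2) homeomorphic_compact_space
    unfolding nonempty_compact_metric_def by blast
qed

definition gh_rel :: "real metric \<Rightarrow> real metric \<Rightarrow> bool" where
  "gh_rel X Y \<longleftrightarrow> nonempty_compact_metric X \<and> nonempty_compact_metric Y \<and> isometric X Y"

quotient_type gh_space = "real metric" / partial: gh_rel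
proof (rule part_equivpI)
  let ?S = "submetric euclidean_metric {0::real}"
  have "nonempty_compact_metric ?S"
    unfolding nonempty_compact_metric_def compact_space_def
    by (intro conjI finite_imp_compactin) auto
  then have "gh_rel ?S ?S"
    by (simp add: gh_rel_def isometric_refl)
  then show "\<exists>X. gh_rel X X" ..
  show "symp gh_rel"
    by (auto simp: symp_def gh_rel_def isometric_sym)
  show "transp gh_rel"
    by (auto simp: transp_def gh_rel_def intro: isometric_trans)
qed

text \<open>
  Only meaningful for nonempty bounded sets, for which all suprema and infima of reals exist;
  it is only applied to images of nonempty compact spaces.
\<close>

definition hausdorff_dist :: "('a \<Rightarrow> 'a \<Rightarrow> real) \<Rightarrow> 'a set \<Rightarrow> 'a set \<Rightarrow> real" where
  "hausdorff_dist d A B = max (SUP x\<in>A. INF y\<in>B. d x y) (SUP y\<in>B. INF x\<in>A. d x y)"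

text \<open>
  The infimum of the Hausdorff distances of the images under isometric embeddings into a common
  metric space \<open>Z\<close>.  Replacing \<open>Z\<close> by the union of the two images does not change the
  Hausdorff distance, and that union again has at most the cardinality of the continuum; hence it
  suffices to let \<open>Z\<close> range over all metric spaces whose carrier is a set of reals.
\<close>

definition gh_dist_metric :: "real metric \<Rightarrow> real metric \<Rightarrow> real" where
  "gh_dist_metric X Y =
     Inf {hausdorff_dist (mdist Z) (f ` mspace X) (g ` mspace Y) | (Z :: real metric) f g.
            isometric_embedding X Z f \<and> isometric_embedding Y Z g}"

lift_definition gh_dist :: "gh_space \<Rightarrow> gh_space \<Rightarrow> real" is gh_dist_metric
proof -
  have *: "{hausdorff_dist (mdist Z) (f ` mspace X) (g ` mspace Y) | (Z :: real metric) f g.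
              isometric_embedding X Z f \<and> isometric_embedding Y Z g}
         \<subseteq> {hausdorff_dist (mdist Z) (f ` mspace X') (g ` mspace Y') | (Z :: real metric) f g.
              isometric_embedding X' Z f \<and> isometric_embedding Y' Z g}"
    if iso: "isometric X X'" "isometric Y Y'" for X X' Y Y' :: "real metric"
  proof -
    obtain h where h: "isometric_embedding X' X h" "h ` mspace X' = mspace X"
      using iso(1) by (metis isometricE)
    obtain k where k: "isometric_embedding Y' Y k" "k ` mspace Y' = mspace Y"
      using iso(2) by (metis isometricE)
    show ?thesis
    proof clarify
      fix Z :: "real metric" and f g
      assume "isometric_embedding X Z f" "isometric_embedding Y Z g"
      then have "isometric_embedding X' Z (f \<circ> h) \<and> isometric_embedding Y' Z (g \<circ> k)"
        using h k isometric_embedding_comp by blast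
      moreover have "f ` mspace X = (f \<circ> h) ` mspace X'" "g ` mspace Y = (g \<circ> k) ` mspace Y'"
        using h k by (metis image_comp)+
      ultimately show "\<exists>(Z' :: real metric) f' g'.
          hausdorff_dist (mdist Z) (f ` mspace X) (g ` mspace Y) =
          hausdorff_dist (mdist Z') (f' ` mspace X') (g' ` mspace Y') \<and>
          isometric_embedding X' Z' f' \<and> isometric_embedding Y' Z' g'"
        by (intro exI[of _ Z] exI[of _ "f \<circ> h"] exI[of _ "g \<circ> k"]) auto
    qed
  qed
  show "gh_dist_metric X Y = gh_dist_metric X' Y'"
    if "gh_rel X X'" "gh_rel Y Y'" for X X' Y Y'
    unfolding gh_dist_metric_def
    using that by (intro arg_cong[where f = Inf] equalityI *) (auto simp: gh_rel_def intro: isometric_sym)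
qed

text \<open>
  The metric topology is spelled out because the facts about \<^const>\<open>Metric_space.mtopology\<close> are
  only available under the metric axioms; \<open>gh_topology_eq_mtopology\<close> relates the two.
\<close>

definition gh_topology :: "gh_space topology" where
  "gh_topology = topology (\<lambda>U. \<forall>X\<in>U. \<exists>r>0. \<forall>Y. gh_dist X Y < r \<longrightarrow> Y \<in> U)"

lemma openin_gh_topology:
  "openin gh_topology U \<longleftrightarrow> (\<forall>X\<in>U. \<exists>r>0. \<forall>Y. gh_dist X Y < r \<longrightarrow> Y \<in> U)"
proof -
  let ?P = "\<lambda>U. \<forall>X\<in>U. \<exists>r>0. \<forall>Y. gh_dist X Y < r \<longrightarrow> Y \<in> U"
  have "?P (S \<inter> T)" if S: "?P S" and T: "?P T" for S T
  proof
    fix X assume "X \<in> S \<inter> T"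
    then obtain r s where "r > 0" "\<forall>Y. gh_dist X Y < r \<longrightarrow> Y \<in> S" "s > 0" "\<forall>Y. gh_dist X Y < s \<longrightarrow> Y \<in> T"
      using S T by blast
    then show "\<exists>r>0. \<forall>Y. gh_dist X Y < r \<longrightarrow> Y \<in> S \<inter> T"
      by (intro exI[of _ "min r s"]) auto
  qed
  moreover have "?P (\<Union>\<K>)" if K: "\<forall>K\<in>\<K>. ?P K" for \<K>
  proof
    fix X assume "X \<in> \<Union>\<K>"
    then obtain K where "K \<in> \<K>" "X \<in> K" by blast
    then show "\<exists>r>0. \<forall>Y. gh_dist X Y < r \<longrightarrow> Y \<in> \<Union>\<K>"
      using K by (meson UnionI)
  qed
  ultimately have "istopology ?P"
    unfolding istopology_def by blast
  then show ?thesis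
    by (simp add: gh_topology_def)
qed

lemma gh_topology_eq_mtopology:
  assumes "Metric_space UNIV gh_dist"
  shows "gh_topology = Metric_space.mtopology UNIV gh_dist"
  unfolding topology_eq openin_gh_topology Metric_space.openin_mtopology[OF assms]
  by (simp add: Metric_space.mball_def[OF assms] subset_iff Ball_def)

lemma topspace_gh_topology [simp]: "topspace gh_topology = UNIV"
proof -
  have "openin gh_topology UNIV"
    by (auto simp: openin_gh_topology intro: exI[of _ 1])
  then show ?thesis
    using openin_subset by blast
qed

definition doubling_with :: "nat \<Rightarrow> 'a metric \<Rightarrow> bool" where
  "doubling_with N X \<longleftrightarrow>
     (\<forall>x\<in>mspace X. \<forall>r>0. \<exists>F\<subseteq>mspace X.
        finite F \<and> card F \<le> N \<and> mcball_of X x r \<subseteq> (\<Union>y\<in>F. mcball_of X y (r / 2)))"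

definition doubling :: "'a metric \<Rightarrow> bool" where
  "doubling X \<longleftrightarrow> (\<exists>N. doubling_with N X)"

text \<open>
  Only the values \<open>z 1, \<dots>, z N\<close> matter.  A non-constant sequence has \<open>N \<ge> 2\<close>, so the maximum
  is taken over a nonempty set.
\<close>

definition uniformly_disconnected_with :: "real \<Rightarrow> 'a metric \<Rightarrow> bool" where
  "uniformly_disconnected_with \<delta> X \<longleftrightarrow>
     (\<forall>N. \<forall>z :: nat \<Rightarrow> 'a.
        (\<forall>i\<in>{1..N}. z i \<in> mspace X) \<and> (\<exists>i\<in>{1..N}. \<exists>j\<in>{1..N}. z i \<noteq> z j) \<longrightarrow>
        \<delta> * mdist X (z 1) (z N) \<le> Max ((\<lambda>i. mdist X (z i) (z (i + 1))) ` {1..N - 1}))"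

definition uniformly_disconnected :: "'a metric \<Rightarrow> bool" where
  "uniformly_disconnected X \<longleftrightarrow> (\<exists>\<delta>>0. uniformly_disconnected_with \<delta> X)"

definition metric_diameter :: "'a metric \<Rightarrow> real" where
  "metric_diameter X = Sup {mdist X x y | x y. x \<in> mspace X \<and> y \<in> mspace X}"

definition uniformly_perfect_with :: "real \<Rightarrow> 'a metric \<Rightarrow> bool" where
  "uniformly_perfect_with c X \<longleftrightarrow>
     (\<forall>x\<in>mspace X. \<forall>r\<in>{0<..<metric_diameter X}.
        \<exists>y\<in>mspace X. c * r \<le> mdist X x y \<and> mdist X x y \<le> r)"

definition uniformly_perfect :: "'a metric \<Rightarrow> bool" where
  "uniformly_perfect X \<longleftrightarrow> (\<exists>c\<in>{0<..<1}. uniformly_perfect_with c X)"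

lemma isometric_doubling_with:
  assumes "isometric X Y" "doubling_with N X" shows "doubling_with N Y"
proof -
  obtain f g where fg: "isometric_embedding X Y f" "isometric_embedding Y X g"
      "\<And>x. x \<in> mspace X \<Longrightarrow> g (f x) = x" "\<And>y. y \<in> mspace Y \<Longrightarrow> f (g y) = y"
    using assms(1) by (metis isometricE)
  have f: "f x \<in> mspace Y" if "x \<in> mspace X" for x
    using fg(1) that by (auto simp: isometric_embedding_def)
  have g: "g y \<in> mspace X" if "y \<in> mspace Y" for y
    using fg(2) that by (auto simp: isometric_embedding_def)
  have dg: "mdist X (g y) (g z) = mdist Y y z" if "y \<in> mspace Y" "z \<in> mspace Y" for y z
    using fg(2) that by (auto simp: isometric_embedding_def)
  show ?thesis
    unfolding doubling_with_def
  proof (intro ballI allI impI)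
    fix y and r :: real assume y: "y \<in> mspace Y" and "r > 0"
    then obtain F where F: "F \<subseteq> mspace X" "finite F" "card F \<le> N"
        "mcball_of X (g y) r \<subseteq> (\<Union>x\<in>F. mcball_of X x (r / 2))"
      using assms(2)[unfolded doubling_with_def, rule_format, OF g[OF y] \<open>r > 0\<close>] by metis
    have "mcball_of Y y r \<subseteq> (\<Union>z\<in>f ` F. mcball_of Y z (r / 2))"
    proof
      fix z assume z: "z \<in> mcball_of Y y r"
      then have "g z \<in> mcball_of X (g y) r"
        using dg g y by simp
      then obtain x where x: "x \<in> F" "g z \<in> mcball_of X x (r / 2)"
        using F(4) by blast
      then have "x \<in> mspace X"
        using F(1) by blast
      then have "mdist Y (f x) z = mdist X x (g z)"
        using dg[of "f x" z] f fg(3) z by simp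
      then show "z \<in> (\<Union>z\<in>f ` F. mcball_of Y z (r / 2))"
        using x z f[OF \<open>x \<in> mspace X\<close>] by (intro UN_I[of "f x"]) auto
    qed
    moreover have "f ` F \<subseteq> mspace Y" "finite (f ` F)" "card (f ` F) \<le> N"
      using F f card_image_le[of F f] by auto
    ultimately show "\<exists>F\<subseteq>mspace Y. finite F \<and> card F \<le> N \<and> mcball_of Y y r \<subseteq> (\<Union>z\<in>F. mcball_of Y z (r / 2))"
      by blast
  qed
qed

lemma isometric_uniformly_disconnected_with:
  assumes "isometric X Y" "uniformly_disconnected_with \<delta> X" shows "uniformly_disconnected_with \<delta> Y"
proof -
  obtain g where g: "isometric_embedding Y X g"
    using assms(1) by (metis isometricE)
  have gX: "g y \<in> mspace X" if "y \<in> mspace Y" for y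
    using g that by (auto simp: isometric_embedding_def)
  have dg: "mdist X (g y) (g z) = mdist Y y z" if "y \<in> mspace Y" "z \<in> mspace Y" for y z
    using g that by (auto simp: isometric_embedding_def)
  show ?thesis
    unfolding uniformly_disconnected_with_def
  proof (intro allI impI)
    fix N and z :: "nat \<Rightarrow> 'b"
    assume z: "(\<forall>i\<in>{1..N}. z i \<in> mspace Y) \<and> (\<exists>i\<in>{1..N}. \<exists>j\<in>{1..N}. z i \<noteq> z j)"
    then have "1 \<le> N"
      by auto
    obtain i j where ij: "i \<in> {1..N}" "j \<in> {1..N}" "z i \<noteq> z j"
      using z by blast
    then have "g (z i) \<noteq> g (z j)"
      using z inj_onD[OF isometric_embedding_inj_on[OF g], of "z i" "z j"] by blast
    then have nonconst: "\<exists>i\<in>{1..N}. \<exists>j\<in>{1..N}. g (z i) \<noteq> g (z j)"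
      using ij by blast
    have "\<forall>i\<in>{1..N}. g (z i) \<in> mspace X"
      using z gX by blast
    with nonconst have "\<delta> * mdist X (g (z 1)) (g (z N)) \<le> Max ((\<lambda>i. mdist X (g (z i)) (g (z (i + 1)))) ` {1..N - 1})"
      using assms(2)[unfolded uniformly_disconnected_with_def, rule_format, of N "\<lambda>i. g (z i)"] by blast
    moreover have "(\<lambda>i. mdist X (g (z i)) (g (z (i + 1)))) ` {1..N - 1} =
        (\<lambda>i. mdist Y (z i) (z (i + 1))) ` {1..N - 1}"
      using z by (intro image_cong refl dg) auto
    ultimately show "\<delta> * mdist Y (z 1) (z N) \<le> Max ((\<lambda>i. mdist Y (z i) (z (i + 1))) ` {1..N - 1})"
      using dg[of "z 1" "z N"] z \<open>1 \<le> N\<close> by simp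
  qed
qed

lemma isometric_metric_diameter:
  assumes "isometric X Y" shows "metric_diameter X = metric_diameter Y"
proof -
  have *: "{mdist X x y | x y. x \<in> mspace X \<and> y \<in> mspace X} \<subseteq> {mdist Y x y | x y. x \<in> mspace Y \<and> y \<in> mspace Y}"
    if "isometric X Y" for X :: "'c metric" and Y :: "'d metric"
  proof -
    obtain f where f: "isometric_embedding X Y f"
      using \<open>isometric X Y\<close> by (metis isometricE)
    then show ?thesis
      unfolding isometric_embedding_def by clarify (metis PiE)
  qed
  show ?thesis
    unfolding metric_diameter_def
    using *[OF assms] *[OF isometric_sym[OF assms]] by (intro arg_cong[where f = Sup] equalityI)
qed

lemma isometric_uniformly_perfect_with:
  assumes "isometric X Y" "uniformly_perfect_with c X" shows "uniformly_perfect_with c Y"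
proof -
  obtain f g where fg: "isometric_embedding X Y f" "isometric_embedding Y X g"
      "\<And>y. y \<in> mspace Y \<Longrightarrow> f (g y) = y"
    using assms(1) by (metis isometricE)
  show ?thesis
    unfolding uniformly_perfect_with_def
  proof (intro ballI)
    fix y r assume y: "y \<in> mspace Y" and r: "r \<in> {0<..<metric_diameter Y}"
    have gy: "g y \<in> mspace X"
      using fg(2) y by (auto simp: isometric_embedding_def)
    then obtain x where x: "x \<in> mspace X" "c * r \<le> mdist X (g y) x" "mdist X (g y) x \<le> r"
      using assms(2) r isometric_metric_diameter[OF assms(1)]
      unfolding uniformly_perfect_with_def by metis
    have "mdist Y y (f x) = mdist X (g y) x" "f x \<in> mspace Y"
      using fg(1) fg(3)[OF y] gy x(1) unfolding isometric_embedding_def by (metis, blast)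
    then show "\<exists>z\<in>mspace Y. c * r \<le> mdist Y y z \<and> mdist Y y z \<le> r"
      using x by (metis)
  qed
qed

lift_definition gh_doubling :: "gh_space \<Rightarrow> bool" is doubling
proof -
  have "doubling Y" if "isometric X Y" "doubling X" for X Y :: "real metric"
    using that isometric_doubling_with[OF that(1)] unfolding doubling_def by blast
  then show "doubling X = doubling Y" if "gh_rel X Y" for X Y
    using that isometric_sym[of X Y] unfolding gh_rel_def by blast
qed

lift_definition gh_uniformly_disconnected :: "gh_space \<Rightarrow> bool" is uniformly_disconnected
proof -
  have "uniformly_disconnected Y" if "isometric X Y" "uniformly_disconnected X" for X Y :: "real metric"
    using that isometric_uniformly_disconnected_with[OF that(1)] unfolding uniformly_disconnected_def by blast
  then show "uniformly_disconnected X = uniformly_disconnected Y" if "gh_rel X Y" for X Y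
    using that isometric_sym[of X Y] unfolding gh_rel_def by blast
qed

lift_definition gh_uniformly_perfect :: "gh_space \<Rightarrow> bool" is uniformly_perfect
proof -
  have "uniformly_perfect Y" if "isometric X Y" "uniformly_perfect X" for X Y :: "real metric"
    using that isometric_uniformly_perfect_with[OF that(1)] unfolding uniformly_perfect_def by blast
  then show "uniformly_perfect X = uniformly_perfect Y" if "gh_rel X Y" for X Y
    using that isometric_sym[of X Y] unfolding gh_rel_def by blast
qed

definition \<Q>\<^sub>1 :: "gh_space set" where "\<Q>\<^sub>1 = {X. gh_doubling X}"
definition \<Q>\<^sub>2 :: "gh_space set" where "\<Q>\<^sub>2 = {X. gh_uniformly_disconnected X}"
definition \<Q>\<^sub>3 :: "gh_space set" where "\<Q>\<^sub>3 = {X. gh_uniformly_perfect X}"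

text \<open>The argument is only meant to be \<open>0\<close>, \<open>1\<close> or \<open>2\<close>.\<close>

definition selected :: "gh_space set \<Rightarrow> nat \<Rightarrow> gh_space set" where
  "selected Q k = (if k = 0 then UNIV - Q else if k = 1 then Q else UNIV)"

definition \<X> :: "nat \<Rightarrow> nat \<Rightarrow> nat \<Rightarrow> gh_space set" where
  "\<X> u v w = selected \<Q>\<^sub>1 u \<inter> selected \<Q>\<^sub>2 v \<inter> selected \<Q>\<^sub>3 w"

definition dense_in :: "'a topology \<Rightarrow> 'a set \<Rightarrow> bool" where
  "dense_in T S \<longleftrightarrow> S \<subseteq> topspace T \<and> T closure_of S = topspace T"

definition fsigma_delta_in :: "'a topology \<Rightarrow> 'a set \<Rightarrow> bool" where
  "fsigma_delta_in T = (countable intersection_of fsigma_in T) relative_to topspace T"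

definition gdelta_sigma_in :: "'a topology \<Rightarrow> 'a set \<Rightarrow> bool" where
  "gdelta_sigma_in T = countable union_of gdelta_in T"

end

theory Submission
  imports Defs
begin

text \<open>
  Each class is a countable union of closed sets, once its defining property is phrased so that a
  violation survives a small Gromov--Hausdorff perturbation: doubling as a bound on the size of
  separated sets in a ball, uniform disconnectedness by chains with small steps, and uniform
  perfectness with an additive slack.  Open sets are \<open>F\<^sub>\<sigma>\<close> because \<^const>\<open>gh_dist\<close> satisfies the
  triangle inequality; this gives the mixed case.

  For density, let \<open>A\<close> be a finite net of a given space, \<open>J\<close> a point or a short interval, and \<open>K\<close>
  a small Cantor space with geometric or harmonic scales.  The product of \<open>A\<close>, \<open>J\<close> and \<open>K\<close> is
  close to the given space and uniformly perfect; \<open>J\<close> decides whether it is uniformly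
  disconnected, \<open>K\<close> whether it is doubling.  Adding one isolated point spoils uniform perfectness
  and changes nothing else.
\<close>

section \<open>Correspondences and the Gromov--Hausdorff distance\<close>

text \<open>The distance is an infimum over embeddings into metric spaces on sets of reals, a form
  in which triangle inequality and approximation are awkward. Correspondences replace it: they
  compose, they relate carriers of different types, and \<open>gh_dist_less_iff\<close> shows that
  they determine the topology.

  For density, three properties must be switched independently. Doubling and uniform
  disconnectedness pass to subspaces and to products, so the product has either of them exactly when
  all its factors do. Uniform perfectness behaves differently: one factor that has points in all
  small annuli suffices, and one isolated point destroys it. Hence \<open>K\<close> can guarantee
  perfectness while its scales still decide doubling: harmonic scales decay too slowly for doubling,
  yet consecutive scales differ at most by the factor 2, just as geometric ones do.\<close>

definition correspondence :: "real \<Rightarrow> 'a metric \<Rightarrow> 'b metric \<Rightarrow> ('a \<Rightarrow> 'b \<Rightarrow> bool) \<Rightarrow> bool" where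
  "correspondence e X Y R \<longleftrightarrow>
     (\<forall>x y. R x y \<longrightarrow> x \<in> mspace X \<and> y \<in> mspace Y) \<and>
     (\<forall>x\<in>mspace X. \<exists>y. R x y) \<and> (\<forall>y\<in>mspace Y. \<exists>x. R x y) \<and>
     (\<forall>x y x' y'. R x y \<longrightarrow> R x' y' \<longrightarrow> \<bar>mdist X x x' - mdist Y y y'\<bar> \<le> 2 * e)"

text \<open>The Gromov-Hausdorff distance is half the infimal distortion of a correspondence, hence
  the factor 2 in \<open>correspondence\<close>: \<open>e\<close> is measured on the scale of the
  distance itself. The carriers may have different types, so spaces built on products can be
  compared directly with spaces on the reals.\<close>

definition gh_close :: "real \<Rightarrow> 'a metric \<Rightarrow> 'b metric \<Rightarrow> bool" where
  "gh_close e X Y \<longleftrightarrow> (\<exists>R. correspondence e X Y R)"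

lemma correspondenceD:
  assumes "correspondence e X Y R"
  shows "\<And>x y. R x y \<Longrightarrow> x \<in> mspace X" "\<And>x y. R x y \<Longrightarrow> y \<in> mspace Y"
    "\<And>x. x \<in> mspace X \<Longrightarrow> \<exists>y. R x y" "\<And>y. y \<in> mspace Y \<Longrightarrow> \<exists>x. R x y"
    "\<And>x y x' y'. \<lbrakk>R x y; R x' y'\<rbrakk> \<Longrightarrow> \<bar>mdist X x x' - mdist Y y y'\<bar> \<le> 2 * e"
  using assms unfolding correspondence_def by blast+

lemma gh_closeI:
  assumes "\<And>x. x \<in> mspace X \<Longrightarrow> \<exists>y\<in>mspace Y. P x y"
    and "\<And>y. y \<in> mspace Y \<Longrightarrow> \<exists>x\<in>mspace X. P x y"
    and "\<And>x y x' y'. \<lbrakk>x \<in> mspace X; y \<in> mspace Y; P x y; x' \<in> mspace X; y' \<in> mspace Y; P x' y'\<rbrakk>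
           \<Longrightarrow> \<bar>mdist X x x' - mdist Y y y'\<bar> \<le> 2 * e"
  shows "gh_close e X Y"
proof -
  have "correspondence e X Y (\<lambda>x y. x \<in> mspace X \<and> y \<in> mspace Y \<and> P x y)"
    unfolding correspondence_def
  proof (intro conjI allI ballI impI)
    show "\<exists>y. x \<in> mspace X \<and> y \<in> mspace Y \<and> P x y" if "x \<in> mspace X" for x
      using assms(1)[OF that] that by blast
    show "\<exists>x. x \<in> mspace X \<and> y \<in> mspace Y \<and> P x y" if "y \<in> mspace Y" for y
      using assms(2)[OF that] that by blast
  qed (use assms(3) in simp_all)
  then show ?thesis
    unfolding gh_close_def by blast
qed

text \<open>A choice function for the correspondence. The last conjunct reaches points of
  \<open>Y\<close> outside the range of \<open>f\<close>; its \<open>x\<close> depends on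
  \<open>y\<close> alone because every comparison uses the same related pair.\<close>

lemma gh_close_map:
  assumes "gh_close e X Y"
  shows "\<exists>f. (\<forall>x\<in>mspace X. f x \<in> mspace Y) \<and>
    (\<forall>x\<in>mspace X. \<forall>x'\<in>mspace X. \<bar>mdist X x x' - mdist Y (f x) (f x')\<bar> \<le> 2 * e) \<and>
    (\<forall>y\<in>mspace Y. \<exists>x\<in>mspace X. \<forall>x'\<in>mspace X. \<bar>mdist X x' x - mdist Y (f x') y\<bar> \<le> 2 * e)"
proof -
  obtain R where "correspondence e X Y R"
    using assms gh_close_def by blast
  note R = correspondenceD[OF this]
  obtain f where f: "\<And>x. x \<in> mspace X \<Longrightarrow> R x (f x)"
    using R(3) by metis
  show ?thesis
  proof (intro exI[of _ f] conjI ballI)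
    show "f x \<in> mspace Y" if "x \<in> mspace X" for x
      by (rule R(2)[OF f[OF that]])
    show "\<bar>mdist X x x' - mdist Y (f x) (f x')\<bar> \<le> 2 * e" if "x \<in> mspace X" "x' \<in> mspace X" for x x'
      by (rule R(5)[OF f[OF that(1)] f[OF that(2)]])
    fix y assume "y \<in> mspace Y"
    then obtain x where x: "R x y"
      using R(4) by blast
    show "\<exists>x\<in>mspace X. \<forall>x'\<in>mspace X. \<bar>mdist X x' x - mdist Y (f x') y\<bar> \<le> 2 * e"
      using R(1)[OF x] R(5)[OF f x] by blast
  qed
qed

lemma gh_close_sym:
  assumes "gh_close e X Y"
  shows "gh_close e Y X"
proof -
  obtain R where "correspondence e X Y R"
    using assms gh_close_def by blast
  then have "correspondence e Y X (\<lambda>y x. R x y)"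
    unfolding correspondence_def by (simp add: abs_minus_commute)
  then show ?thesis
    unfolding gh_close_def by blast
qed

text \<open>Composing relations adds their distortions. This is the triangle inequality in the form
  used by \<open>open_imp_fsigma_in_gh\<close> and by the two-stage approximation.\<close>

lemma gh_close_trans:
  assumes "gh_close e X Y" "gh_close e' Y Z"
  shows "gh_close (e + e') X Z"
proof -
  obtain R where "correspondence e X Y R"
    using assms(1) gh_close_def by blast
  note R = correspondenceD[OF this]
  obtain S where "correspondence e' Y Z S"
    using assms(2) gh_close_def by blast
  note S = correspondenceD[OF this]
  show ?thesis
  proof (rule gh_closeI[where P = "\<lambda>x z. \<exists>y. R x y \<and> S y z"])
    show "\<exists>z\<in>mspace Z. \<exists>y. R x y \<and> S y z" if "x \<in> mspace X" for x
      using that R(2,3) S(2,3) by meson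
    show "\<exists>x\<in>mspace X. \<exists>y. R x y \<and> S y z" if "z \<in> mspace Z" for z
      using that R(1,4) S(1,4) by meson
  next
    fix x z x' z' assume "\<exists>y. R x y \<and> S y z" "\<exists>y. R x' y \<and> S y z'"
    then obtain y y' where "R x y" "S y z" "R x' y'" "S y' z'"
      by blast
    then show "\<bar>mdist X x x' - mdist Z z z'\<bar> \<le> 2 * (e + e')"
      using R(5)[of x y x' y'] S(5)[of y z y' z'] by (auto simp: abs_le_iff)
  qed
qed

lemma gh_close_isometric:
  assumes "isometric X Y" "0 \<le> e"
  shows "gh_close e X Y"
proof -
  obtain f where f: "isometric_embedding X Y f" "f ` mspace X = mspace Y"
    using assms(1) unfolding isometric_def by blast
  then show ?thesis
    using assms(2) by (intro gh_closeI[where P = "\<lambda>x y. y = f x"]) (auto simp: isometric_embedding_def)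
qed

lemma gh_close_cong:
  assumes "gh_close e X Y" "isometric X X'" "isometric Y Y'"
  shows "gh_close e X' Y'"
  using gh_close_trans[OF gh_close_trans[OF gh_close_isometric[OF isometric_sym[OF assms(2)] order_refl] assms(1)]
    gh_close_isometric[OF assms(3) order_refl]] by simp

lemma mdist_bounded:
  assumes "nonempty_compact_metric X"
  shows "\<exists>D>0. \<forall>x\<in>mspace X. \<forall>y\<in>mspace X. mdist X x y \<le> D"
proof -
  interpret M: Metric_space "mspace X" "mdist X"
    by simp
  have "M.mbounded (mspace X)"
    using assms M.compactin_imp_mbounded[of "mspace X"]
    by (simp add: nonempty_compact_metric_def mtopology_of_def compact_space_def)
  then obtain D where "\<forall>x\<in>mspace X. \<forall>y\<in>mspace X. mdist X x y \<le> D"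
    unfolding M.mbounded_alt by blast
  then show ?thesis
    by (intro exI[of _ "max D 1"]) (auto simp: le_max_iff_disj)
qed

text \<open>An injection transports the metric to its range; this is how the glued space, built on a
  sum type, is placed on the reals.\<close>

lemma metric_pullback:
  assumes h: "inj_on h (mspace M)"
  shows "\<exists>Z :: 'b metric. isometric_embedding M Z h"
proof -
  define g where "g = inv_into (mspace M) h"
  have gh: "g (h x) = x" if "x \<in> mspace M" for x
    using h that by (simp add: g_def)
  interpret S: Metric_space "h ` mspace M"
    "\<lambda>a b. if a \<in> h ` mspace M \<and> b \<in> h ` mspace M then mdist M (g a) (g b) else 0"
    by unfold_locales (auto simp: gh mdist_commute mdist_triangle)
  have "isometric_embedding M S.Self h"
    unfolding isometric_embedding_def S.mspace_Self S.mdist_Self by (auto simp: gh)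
  then show ?thesis
    by blast
qed

section \<open>Estimates for the Hausdorff distance\<close>

lemma hausdorff_dist_commute: "hausdorff_dist d A B = hausdorff_dist (\<lambda>x y. d y x) B A"
  by (simp add: hausdorff_dist_def max.commute)

lemma bdd_below_image_nonneg: "(\<And>x. 0 \<le> f x) \<Longrightarrow> bdd_below (f ` S)" for f :: "'a \<Rightarrow> real"
  by (rule bdd_belowI2[where m = 0])

text \<open>The bound \<open>D\<close> makes the family of infima bounded above, so that the real
  supremum dominates each of them.\<close>

lemma hausdorff_dist_less_imp_close:
  assumes D: "\<And>x y. \<lbrakk>x \<in> A; y \<in> B\<rbrakk> \<Longrightarrow> d x y \<le> D"
    and nonneg: "\<And>x y. 0 \<le> d x y"
    and "B \<noteq> {}" and less: "hausdorff_dist d A B < e" and "x \<in> A"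
  shows "\<exists>y\<in>B. d x y < e"
proof -
  obtain b where b: "b \<in> B"
    using \<open>B \<noteq> {}\<close> by blast
  have bdd: "bdd_below (d x ` B)" for x
    by (rule bdd_below_image_nonneg[OF nonneg])
  have "(INF y\<in>B. d x y) \<le> D" if "x \<in> A" for x
    by (rule cINF_lower2[OF bdd b D[OF that b]])
  then have "bdd_above ((\<lambda>x. INF y\<in>B. d x y) ` A)"
    by (rule bdd_aboveI2)
  then have "(INF y\<in>B. d x y) \<le> (SUP x\<in>A. INF y\<in>B. d x y)"
    using \<open>x \<in> A\<close> by (intro cSUP_upper)
  then have "(INF y\<in>B. d x y) < e"
    using less by (simp add: hausdorff_dist_def)
  then show ?thesis
    by (simp only: cINF_less_iff[OF \<open>B \<noteq> {}\<close> bdd])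
qed

lemma SUP_INF_le:
  fixes d :: "'a \<Rightarrow> 'b \<Rightarrow> real"
  assumes nonneg: "\<And>x y. 0 \<le> d x y" and "A \<noteq> {}" and ex: "\<And>x. x \<in> A \<Longrightarrow> \<exists>y\<in>B. d x y \<le> e"
  shows "(SUP x\<in>A. INF y\<in>B. d x y) \<le> e"
proof (rule cSUP_least[OF \<open>A \<noteq> {}\<close>])
  fix x assume "x \<in> A"
  then obtain y where y: "y \<in> B" "d x y \<le> e"
    using ex by blast
  have bdd: "bdd_below (d x ` B)"
    by (rule bdd_below_image_nonneg[OF nonneg])
  show "(INF y\<in>B. d x y) \<le> e"
    by (rule cINF_lower2[OF bdd y])
qed

lemma hausdorff_dist_le:
  assumes nonneg: "\<And>x y. 0 \<le> d x y" and "A \<noteq> {}" "B \<noteq> {}"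
    and "\<And>x. x \<in> A \<Longrightarrow> \<exists>y\<in>B. d x y \<le> e" "\<And>y. y \<in> B \<Longrightarrow> \<exists>x\<in>A. d x y \<le> e"
  shows "hausdorff_dist d A B \<le> e"
  unfolding hausdorff_dist_def
  using SUP_INF_le[of d A B e] SUP_INF_le[of "\<lambda>y x. d x y" B A e] assms by (intro max.boundedI) blast+

section \<open>Passage between embeddings and correspondences\<close>

lemma embedding_mdist_bounded:
  assumes "nonempty_compact_metric X" "nonempty_compact_metric Y"
    and f: "isometric_embedding X Z f" and g: "isometric_embedding Y Z g"
  shows "\<exists>D. \<forall>a\<in>f ` mspace X. \<forall>b\<in>g ` mspace Y. mdist Z a b \<le> D"
proof -
  obtain x0 y0 where x0: "x0 \<in> mspace X" and y0: "y0 \<in> mspace Y"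
    using assms by (auto simp: nonempty_compact_metric_def)
  obtain D where D: "\<And>x y. \<lbrakk>x \<in> mspace X; y \<in> mspace X\<rbrakk> \<Longrightarrow> mdist X x y \<le> D"
    using mdist_bounded[OF assms(1)] by blast
  obtain E where E: "\<And>x y. \<lbrakk>x \<in> mspace Y; y \<in> mspace Y\<rbrakk> \<Longrightarrow> mdist Y x y \<le> E"
    using mdist_bounded[OF assms(2)] by blast
  show ?thesis
  proof (intro exI ballI, clarify)
    fix x y assume xy: "x \<in> mspace X" "y \<in> mspace Y"
    have "f x \<in> mspace Z" "f x0 \<in> mspace Z" "g y \<in> mspace Z" "g y0 \<in> mspace Z"
      using f g xy x0 y0 by (auto simp: isometric_embedding_def)
    then have "mdist Z (f x) (g y) \<le> mdist Z (f x) (f x0) + (mdist Z (f x0) (g y0) + mdist Z (g y0) (g y))"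
      by (meson add_left_mono mdist_triangle order_trans)
    moreover have "mdist Z (f x) (f x0) \<le> D" "mdist Z (g y0) (g y) \<le> E"
      using f g D E xy x0 y0 by (auto simp: isometric_embedding_def)
    ultimately show "mdist Z (f x) (g y) \<le> D + mdist Z (f x0) (g y0) + E"
      by simp
  qed
qed

lemma hausdorff_dist_less_imp_gh_close:
  assumes "nonempty_compact_metric X" "nonempty_compact_metric Y"
    and f: "isometric_embedding X Z f" and g: "isometric_embedding Y Z g"
    and less: "hausdorff_dist (mdist Z) (f ` mspace X) (g ` mspace Y) < e"
  shows "gh_close e X Y"
proof -
  obtain D where D: "\<And>a b. \<lbrakk>a \<in> f ` mspace X; b \<in> g ` mspace Y\<rbrakk> \<Longrightarrow> mdist Z a b \<le> D"
    using embedding_mdist_bounded[OF assms(1-4)] by blast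
  have ne: "f ` mspace X \<noteq> {}" "g ` mspace Y \<noteq> {}"
    using assms(1,2) by (auto simp: nonempty_compact_metric_def)
  show ?thesis
  \<comment> \<open>Points whose images are closer than \<open>e\<close> correspond. A distance then
    changes by at most the two connecting distances, hence by at most \<open>2 * e\<close>.\<close>
  proof (rule gh_closeI[where P = "\<lambda>x y. mdist Z (f x) (g y) < e"])
    show "\<exists>y\<in>mspace Y. mdist Z (f x) (g y) < e" if "x \<in> mspace X" for x
      using hausdorff_dist_less_imp_close[of _ _ "mdist Z", OF D mdist_nonneg ne(2) less imageI[OF that]]
      by blast
    have less': "hausdorff_dist (mdist Z) (g ` mspace Y) (f ` mspace X) < e"
      using less hausdorff_dist_commute[of "mdist Z" "g ` mspace Y"] by (simp add: mdist_commute[of Z])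
    have D': "mdist Z b a \<le> D" if "b \<in> g ` mspace Y" "a \<in> f ` mspace X" for a b
      using D[OF that(2,1)] by (simp add: mdist_commute)
    show "\<exists>x\<in>mspace X. mdist Z (f x) (g y) < e" if "y \<in> mspace Y" for y
      using hausdorff_dist_less_imp_close[of _ _ "mdist Z", OF D' mdist_nonneg ne(1) less' imageI[OF that]]
      by (metis imageE mdist_commute)
  next
    fix x y x' y' assume xy: "x \<in> mspace X" "y \<in> mspace Y" "mdist Z (f x) (g y) < e"
      "x' \<in> mspace X" "y' \<in> mspace Y" "mdist Z (f x') (g y') < e"
    have in_Z: "f x \<in> mspace Z" "f x' \<in> mspace Z" "g y \<in> mspace Z" "g y' \<in> mspace Z"
      using f g xy by (auto simp: isometric_embedding_def)
    have "mdist Z (f x) (f x') \<le> mdist Z (f x) (g y) + mdist Z (g y) (g y') + mdist Z (f x') (g y')"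
         "mdist Z (g y) (g y') \<le> mdist Z (f x) (g y) + mdist Z (f x) (f x') + mdist Z (f x') (g y')"
      using mdist_triangle[of "f x" Z "g y" "f x'"] mdist_triangle[of "g y" Z "g y'" "f x'"]
        mdist_triangle[of "g y" Z "f x" "g y'"] mdist_triangle[of "f x" Z "f x'" "g y'"] in_Z
      by (simp_all add: mdist_commute)
    then show "\<bar>mdist X x x' - mdist Y y y'\<bar> \<le> 2 * e"
      using f g xy by (auto simp: isometric_embedding_def abs_le_iff)
  qed
qed

text \<open>
  The disjoint union is metrized by going through the cheapest corresponding pair, where crossing
  over costs \<open>e\<close>.
\<close>

lemma gh_close_imp_embeddings:
  fixes X Y :: "real metric"
  assumes "gh_close e X Y" "e > 0" "nonempty_compact_metric X" "nonempty_compact_metric Y"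
  shows "\<exists>(Z :: real metric) f g. isometric_embedding X Z f \<and> isometric_embedding Y Z g \<and>
    hausdorff_dist (mdist Z) (f ` mspace X) (g ` mspace Y) \<le> e"
proof -
  obtain R where "correspondence e X Y R"
    using assms(1) gh_close_def by blast
  note R = correspondenceD[OF this]
  obtain p0 q0 where pq0: "R p0 q0"
    using assms(3) R(3) unfolding nonempty_compact_metric_def by blast
  define D where "D x y = (INF (p, q)\<in>{(p, q). R p q}. mdist X x p + e + mdist Y q y)" for x y
  have D_le: "D x y \<le> mdist X x p + e + mdist Y q y" if "R p q" for p q x y
    unfolding D_def using that \<open>e > 0\<close>
    by (intro cINF_lower2[where x = "(p, q)"]) (auto intro!: bdd_belowI2[where m = 0])
  have le_D: "t \<le> D x y" if "\<And>p q. R p q \<Longrightarrow> t \<le> mdist X x p + e + mdist Y q y" for t x y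
    unfolding D_def using that pq0 by (intro cINF_greatest) auto
  have D_ge: "e \<le> D x y" for x y
    by (rule le_D) simp
  have D_tri: "D x y \<le> mdist X x x' + D x' y" if "x \<in> mspace X" "x' \<in> mspace X" for x x' y
  proof -
    have "D x y - mdist X x x' \<le> mdist X x' p + e + mdist Y q y" if "R p q" for p q
      using D_le[OF that, of x y] mdist_triangle[OF \<open>x \<in> mspace X\<close> \<open>x' \<in> mspace X\<close> R(1)[OF that]] by linarith
    then show ?thesis
      using le_D[of "D x y - mdist X x x'"] by fastforce
  qed
  have D_tri': "D x y \<le> D x y' + mdist Y y' y" if "y \<in> mspace Y" "y' \<in> mspace Y" for x y y'
  proof -
    have "D x y - mdist Y y' y \<le> mdist X x p + e + mdist Y q y'" if "R p q" for p q
      using D_le[OF that, of x y] mdist_triangle[OF R(2)[OF that] \<open>y' \<in> mspace Y\<close> \<open>y \<in> mspace Y\<close>] by linarith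
    then show ?thesis
      using le_D[of "D x y - mdist Y y' y"] by fastforce
  qed
  have D_tri2: "D x y \<le> D x' y + mdist X x' x" if "x \<in> mspace X" "x' \<in> mspace X" for x x' y
    using D_tri[OF that, of y] by (simp add: mdist_commute)
  have D_tri2': "D x y \<le> mdist Y y y' + D x y'" if "y \<in> mspace Y" "y' \<in> mspace Y" for x y y'
    using D_tri'[OF that, of x] by (simp add: mdist_commute)
  \<comment> \<open>The delicate triangle inequality, through a point of the other space: crossing
    twice costs \<open>2 * e\<close>, exactly what the distortion may have saved on the way.\<close>
  have X_le: "mdist X x x' \<le> D x y + D x' y"
    if "x \<in> mspace X" "x' \<in> mspace X" "y \<in> mspace Y" for x x' y
  proof -
    have "mdist X x x' \<le> (mdist X x p + e + mdist Y q y) + (mdist X x' p' + e + mdist Y q' y)"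
      if "R p q" "R p' q'" for p q p' q'
      using mdist_triangle[OF \<open>x \<in> mspace X\<close> R(1)[OF that(1)] \<open>x' \<in> mspace X\<close>]
        mdist_triangle[OF R(1)[OF that(1)] R(1)[OF that(2)] \<open>x' \<in> mspace X\<close>]
        mdist_triangle[OF R(2)[OF that(1)] \<open>y \<in> mspace Y\<close> R(2)[OF that(2)]] R(5)[OF that]
      by (simp add: mdist_commute abs_le_iff)
    \<comment> \<open>The two infima are handled one at a time, with the other crossing pair held
      fixed.\<close>
    then have "mdist X x x' - (mdist X x p + e + mdist Y q y) \<le> D x' y" if "R p q" for p q
      using that by (intro le_D) (smt (verit, best))
    then have "mdist X x x' - D x' y \<le> D x y"
      by (intro le_D) (smt (verit, best))
    then show ?thesis by simp
  qed
  have Y_le: "mdist Y y y' \<le> D x y + D x y'"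
    if "y \<in> mspace Y" "y' \<in> mspace Y" "x \<in> mspace X" for x y y'
  proof -
    have "mdist Y y y' \<le> (mdist X x p + e + mdist Y q y) + (mdist X x p' + e + mdist Y q' y')"
      if "R p q" "R p' q'" for p q p' q'
      using mdist_triangle[OF \<open>y \<in> mspace Y\<close> R(2)[OF that(1)] \<open>y' \<in> mspace Y\<close>]
        mdist_triangle[OF R(2)[OF that(1)] R(2)[OF that(2)] \<open>y' \<in> mspace Y\<close>]
        mdist_triangle[OF R(1)[OF that(1)] \<open>x \<in> mspace X\<close> R(1)[OF that(2)]] R(5)[OF that]
      by (simp add: mdist_commute abs_le_iff)
    then have "mdist Y y y' - (mdist X x p + e + mdist Y q y) \<le> D x y'" if "R p q" for p q
      using that by (intro le_D) (smt (verit, best))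
    then have "mdist Y y y' - D x y' \<le> D x y"
      by (intro le_D) (smt (verit, best))
    then show ?thesis by simp
  qed
  define d where "d a b = (case (a, b) of
      (Inl x, Inl x') \<Rightarrow> mdist X x x' | (Inr y, Inr y') \<Rightarrow> mdist Y y y'
    | (Inl x, Inr y) \<Rightarrow> D x y | (Inr y, Inl x) \<Rightarrow> D x y)" for a b
  \<comment> \<open>The positive crossing cost keeps the two copies apart, so that \<open>d\<close>
    vanishes only on the diagonal.\<close>
  have D_pos: "0 < D x y" for x y
    using D_ge[of x y] \<open>e > 0\<close> by linarith
  interpret M: Metric_space "mspace X <+> mspace Y" d
  proof
    show "0 \<le> d a b" for a b
      using D_pos by (auto simp: d_def less_imp_le split: sum.split)
    show "d a b = d b a" for a b
      by (auto simp: d_def mdist_commute split: sum.split)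
    show "(d a b = 0) = (a = b)" if "a \<in> mspace X <+> mspace Y" "b \<in> mspace X <+> mspace Y" for a b
      using D_pos that by (auto simp: d_def less_le split: sum.split)
    show "d a c \<le> d a b + d b c"
      if "a \<in> mspace X <+> mspace Y" "b \<in> mspace X <+> mspace Y" "c \<in> mspace X <+> mspace Y" for a b c
      using that D_tri D_tri' D_tri2 D_tri2' X_le Y_le mdist_triangle by (auto simp: d_def)
  qed
  \<comment> \<open>The two copies of the reals go injectively to the positive and to the negative
    half-line.\<close>
  define h :: "real + real \<Rightarrow> real" where "h = case_sum exp (\<lambda>x. - exp x)"
  have "exp x \<noteq> - exp y" "- exp y \<noteq> exp x" for x y :: real
    using exp_gt_zero[of x] exp_gt_zero[of y] by linarith+
  then have "inj_on h (mspace M.Self)"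
    unfolding h_def inj_on_def by (simp split: sum.split)
  then obtain Z :: "real metric" where Z: "isometric_embedding M.Self Z h"
    using metric_pullback by blast
  have "isometric_embedding X M.Self Inl" "isometric_embedding Y M.Self Inr"
    by (auto simp: isometric_embedding_def d_def)
  then have emb: "isometric_embedding X Z (h \<circ> Inl)" "isometric_embedding Y Z (h \<circ> Inr)"
    using isometric_embedding_comp Z by blast+
  have Z_D: "mdist Z (h (Inl x)) (h (Inr y)) \<le> e" if "R x y" for x y
  proof -
    have "mdist Z (h (Inl x)) (h (Inr y)) = D x y"
      using Z R(1,2)[OF that] unfolding isometric_embedding_def
      by (simp add: InlI InrI) (simp add: d_def)
    also have "\<dots> \<le> e"
      using D_le[OF that, of x y] mdist_zero R(1,2)[OF that] by (metis add.right_neutral add_0)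
    finally show ?thesis .
  qed
  have haus: "hausdorff_dist (mdist Z) ((h \<circ> Inl) ` mspace X) ((h \<circ> Inr) ` mspace Y) \<le> e"
  proof (rule hausdorff_dist_le)
    show "\<exists>b\<in>(h \<circ> Inr) ` mspace Y. mdist Z a b \<le> e" if a: "a \<in> (h \<circ> Inl) ` mspace X" for a
    proof -
      obtain x where "x \<in> mspace X" "a = h (Inl x)"
        using a unfolding image_iff comp_def by blast
      moreover obtain y where "R x y"
        using R(3) \<open>x \<in> mspace X\<close> by blast
      ultimately show ?thesis
        using R(2) Z_D by (intro bexI[of _ "h (Inr y)"]) auto
    qed
    show "\<exists>a\<in>(h \<circ> Inl) ` mspace X. mdist Z a b \<le> e" if b: "b \<in> (h \<circ> Inr) ` mspace Y" for b
    proof -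
      obtain y where "y \<in> mspace Y" "b = h (Inr y)"
        using b unfolding image_iff comp_def by blast
      moreover obtain x where "R x y"
        using R(4) \<open>y \<in> mspace Y\<close> by blast
      ultimately show ?thesis
        using R(1) Z_D by (intro bexI[of _ "h (Inl x)"]) auto
    qed
  qed (use assms in \<open>auto simp: nonempty_compact_metric_def\<close>)
  show ?thesis
    by (intro exI[of _ Z] exI[of _ "h \<circ> Inl"] exI[of _ "h \<circ> Inr"] conjI emb haus)
qed

text \<open>A negative value would produce two points at negative distance. This bounds the set in
  \<open>gh_dist_metric\<close> from below, so that its infimum lies below each member.\<close>

lemma hausdorff_dist_nonneg:
  assumes "nonempty_compact_metric X" "nonempty_compact_metric Y"
    and "isometric_embedding X Z f" "isometric_embedding Y Z g"
  shows "0 \<le> hausdorff_dist (mdist Z) (f ` mspace X) (g ` mspace Y)"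
proof (rule ccontr)
  assume neg: "\<not> ?thesis"
  obtain D where D: "\<And>a b. \<lbrakk>a \<in> f ` mspace X; b \<in> g ` mspace Y\<rbrakk> \<Longrightarrow> mdist Z a b \<le> D"
    using embedding_mdist_bounded[OF assms] by blast
  have ne: "f ` mspace X \<noteq> {}" "g ` mspace Y \<noteq> {}"
    using assms(1,2) by (auto simp: nonempty_compact_metric_def)
  obtain a where a: "a \<in> f ` mspace X"
    using ne by blast
  have less: "hausdorff_dist (mdist Z) (f ` mspace X) (g ` mspace Y) < 0"
    using neg by simp
  obtain b where "mdist Z a b < 0"
    using hausdorff_dist_less_imp_close[of _ _ "mdist Z", OF D mdist_nonneg ne(2) less a] by blast
  then show False
    by (metis mdist_nonneg not_less)
qed

lemma gh_close_imp_gh_dist_metric_le: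
  assumes "gh_close e X Y" "e > 0" "nonempty_compact_metric X" "nonempty_compact_metric Y"
  shows "gh_dist_metric X Y \<le> e"
proof -
  obtain Z :: "real metric" and f g where Z: "isometric_embedding X Z f" "isometric_embedding Y Z g"
    "hausdorff_dist (mdist Z) (f ` mspace X) (g ` mspace Y) \<le> e"
    using gh_close_imp_embeddings[OF assms] by blast
  show ?thesis
    unfolding gh_dist_metric_def
  proof (rule cInf_lower2[OF _ Z(3)])
    show "bdd_below {hausdorff_dist (mdist Z) (f ` mspace X) (g ` mspace Y) | (Z :: real metric) f g.
        isometric_embedding X Z f \<and> isometric_embedding Y Z g}"
      using hausdorff_dist_nonneg[OF assms(3,4)] by (intro bdd_belowI[where m = 0]) auto
  qed (use Z(1,2) in auto)
qed

lemma gh_dist_metric_less_imp_gh_close: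
  assumes "gh_dist_metric X Y < e" "nonempty_compact_metric X" "nonempty_compact_metric Y"
  shows "gh_close e X Y"
proof -
  obtain D where D: "D > 0" "\<And>x y. \<lbrakk>x \<in> mspace X; y \<in> mspace X\<rbrakk> \<Longrightarrow> mdist X x y \<le> D"
    using mdist_bounded[OF assms(2)] by blast
  obtain E where E: "E > 0" "\<And>x y. \<lbrakk>x \<in> mspace Y; y \<in> mspace Y\<rbrakk> \<Longrightarrow> mdist Y x y \<le> E"
    using mdist_bounded[OF assms(3)] by blast
  \<comment> \<open>The total relation is a correspondence between bounded spaces. The embeddings
    that it yields show that the set under the infimum is nonempty, as \<open>cInf_lessD\<close>
    requires.\<close>
  have "gh_close (D + E) X Y"
  proof (rule gh_closeI[where P = "\<lambda>_ _. True"])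
    fix x y x' y' assume "x \<in> mspace X" "y \<in> mspace Y" "x' \<in> mspace X" "y' \<in> mspace Y"
    then have "mdist X x x' \<le> D" "mdist Y y y' \<le> E"
      using D(2) E(2) by blast+
    then show "\<bar>mdist X x x' - mdist Y y y'\<bar> \<le> 2 * (D + E)"
      using D(1) E(1) mdist_nonneg[of X x x'] mdist_nonneg[of Y y y'] by (smt (verit))
  qed (use assms(2,3) in \<open>auto simp: nonempty_compact_metric_def\<close>)
  then obtain Z :: "real metric" and f g where "isometric_embedding X Z f" "isometric_embedding Y Z g"
    using gh_close_imp_embeddings[OF _ add_pos_pos[OF D(1) E(1)] assms(2,3)] by blast
  then have "{hausdorff_dist (mdist Z) (f ` mspace X) (g ` mspace Y) | (Z :: real metric) f g.
            isometric_embedding X Z f \<and> isometric_embedding Y Z g} \<noteq> {}"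
    by auto
  from cInf_lessD[OF this assms(1)[unfolded gh_dist_metric_def]]
  obtain Z :: "real metric" and f g where Z: "isometric_embedding X Z f" "isometric_embedding Y Z g"
    "hausdorff_dist (mdist Z) (f ` mspace X) (g ` mspace Y) < e"
    by auto
  show ?thesis
    by (rule hausdorff_dist_less_imp_gh_close[OF assms(2,3) Z])
qed

text \<open>Later arguments reach the distance through this equivalence. The strict bound turns an
  infimum into an actual correspondence, and the room below \<open>e\<close> allows a positive
  \<open>e'\<close> even at distance 0.\<close>

lemma gh_dist_metric_less_iff:
  assumes "nonempty_compact_metric X" "nonempty_compact_metric Y"
  shows "gh_dist_metric X Y < e \<longleftrightarrow> (\<exists>e'<e. 0 < e' \<and> gh_close e' X Y)"
proof
  assume "gh_dist_metric X Y < e"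
  \<comment> \<open>Nonnegativity puts a positive \<open>e'\<close> within reach: a negative
    distance would give a correspondence with a negative bound on an absolute value.\<close>
  moreover have "0 \<le> gh_dist_metric X Y"
  proof (rule ccontr)
    assume "\<not> 0 \<le> gh_dist_metric X Y"
    then obtain e where "e < 0" "gh_dist_metric X Y < e"
      using dense[of "gh_dist_metric X Y" 0] by auto
    then have "gh_close e X Y"
      using gh_dist_metric_less_imp_gh_close assms by blast
    then obtain R where "correspondence e X Y R"
      using gh_close_def by blast
    note R = correspondenceD(3,5)[OF this]
    obtain x where "x \<in> mspace X"
      using assms(1) by (auto simp: nonempty_compact_metric_def)
    then obtain y where "R x y"
      using R(1) by blast
    then show False
      using R(2)[of x y x y] \<open>e < 0\<close> by linarith
  qed
  ultimately obtain e' where "gh_dist_metric X Y < e'" "e' < e" "0 < e'"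
    using dense[of "gh_dist_metric X Y" e] by auto
  then show "\<exists>e'<e. 0 < e' \<and> gh_close e' X Y"
    using gh_dist_metric_less_imp_gh_close assms by blast
next
  assume "\<exists>e'<e. 0 < e' \<and> gh_close e' X Y"
  then show "gh_dist_metric X Y < e"
    using gh_close_imp_gh_dist_metric_le assms by fastforce
qed

section \<open>Borel classes in the Gromov--Hausdorff space\<close>

lemma rep_gh_space_compact: "nonempty_compact_metric (rep_gh_space X)"
  using Quotient_rep_reflp[OF Quotient_gh_space, of X] by (simp add: gh_rel_def)

lemma isometric_rep_abs_gh_space:
  assumes "nonempty_compact_metric M"
  shows "isometric (rep_gh_space (abs_gh_space M)) M"
proof -
  have "gh_rel M M"
    using assms by (simp add: gh_rel_def isometric_refl)
  then show ?thesis
    using Quotient_rep_abs[OF Quotient_gh_space, of M] by (simp add: gh_rel_def)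
qed

lemma gh_dist_less_iff:
  "gh_dist X Y < e \<longleftrightarrow> (\<exists>e'<e. 0 < e' \<and> gh_close e' (rep_gh_space X) (rep_gh_space Y))"
  by (simp add: gh_dist.rep_eq gh_dist_metric_less_iff rep_gh_space_compact)

text \<open>If failure of \<open>P\<close> is stable, the complement is open. The hypothesis speaks
  of metrics on the reals and of correspondences, so the closedness proofs never meet the
  quotient.\<close>

lemma closedin_gh_topologyI:
  assumes "\<And>X :: real metric. \<not> P X \<Longrightarrow>
    \<exists>e>0. \<forall>(Y :: real metric) e'. 0 < e' \<longrightarrow> e' < e \<longrightarrow> gh_close e' X Y \<longrightarrow> \<not> P Y"
  shows "closedin gh_topology {X. P (rep_gh_space X)}"
proof -
  have "\<exists>r>0. \<forall>Y. gh_dist X Y < r \<longrightarrow> \<not> P (rep_gh_space Y)" if "\<not> P (rep_gh_space X)" for X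
    using assms[OF that] unfolding gh_dist_less_iff by blast
  then have "openin gh_topology {X. \<not> P (rep_gh_space X)}"
    by (auto simp: openin_gh_topology)
  then show ?thesis
    by (simp add: closedin_def Collect_neg_eq[symmetric] Compl_eq_Diff_UNIV[symmetric])
qed

lemma fsigma_in_UN_closedin:
  assumes "\<And>n :: nat. closedin T (C n)"
  shows "fsigma_in T (\<Union>n. C n)"
  using assms by (intro fsigma_in_Union) (auto intro: closed_imp_fsigma_in)

text \<open>The set is exhausted by those points whose ball of radius
  \<open>1 / real (Suc n)\<close> stays inside it; the triangle inequality makes each of these sets
  closed.\<close>

lemma open_imp_fsigma_in_gh:
  assumes U: "openin gh_topology U"
  shows "fsigma_in gh_topology U"
proof -
  define C where "C n = {X. \<forall>Y. gh_dist X Y < 1 / real (Suc n) \<longrightarrow> Y \<in> U}" for n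
  have "\<exists>n. X \<in> C n" if X: "X \<in> U" for X
  proof -
    obtain r where r: "r > 0" "\<forall>Y. gh_dist X Y < r \<longrightarrow> Y \<in> U"
      using U X unfolding openin_gh_topology by blast
    obtain n where n: "1 / real (Suc n) < r"
      using nat_approx_posE[OF r(1)] .
    have "X \<in> C n"
      unfolding C_def using r(2) order_less_trans[OF _ n] by blast
    then show ?thesis ..
  qed
  moreover have "X \<in> U" if "X \<in> C n" for X n
  proof -
    \<comment> \<open>\<open>gh_dist_less_iff\<close> asks for a positive radius below the bound, so
      reflexivity is used with the next smaller reciprocal rather than with 0.\<close>
    have "gh_close (1 / real (Suc (Suc n))) (rep_gh_space X) (rep_gh_space X)"
      by (simp add: gh_close_isometric isometric_refl)
    moreover have "1 / real (Suc (Suc n)) < 1 / real (Suc n)" "0 < 1 / real (Suc (Suc n))"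
      by (auto intro!: divide_strict_left_mono)
    ultimately have "gh_dist X X < 1 / real (Suc n)"
      unfolding gh_dist_less_iff by blast
    then show ?thesis
      using that unfolding C_def by blast
  qed
  ultimately have eq: "U = (\<Union>n. C n)"
    by blast
  have "closedin gh_topology (C n)" for n
  proof -
    have "\<exists>r>0. \<forall>Y. gh_dist X Y < r \<longrightarrow> Y \<in> - C n" if X: "X \<in> - C n" for X
    proof -
      obtain Z where Z: "gh_dist X Z < 1 / real (Suc n)" "Z \<notin> U"
        using X unfolding C_def by blast
      then obtain e where e: "e < 1 / real (Suc n)" "0 < e" "gh_close e (rep_gh_space X) (rep_gh_space Z)"
        unfolding gh_dist_less_iff by blast
      \<comment> \<open>The slack left by \<open>e\<close> pays for the move from \<open>X\<close>
        to \<open>Y\<close>, so \<open>Z\<close> still witnesses that \<open>Y\<close> is outside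
        \<open>C n\<close>.\<close>
      have "Y \<in> - C n" if XY: "gh_dist X Y < 1 / real (Suc n) - e" for Y
      proof -
        obtain e' where e': "e' < 1 / real (Suc n) - e" "0 < e'" "gh_close e' (rep_gh_space X) (rep_gh_space Y)"
          using XY unfolding gh_dist_less_iff by blast
        have "gh_close (e' + e) (rep_gh_space Y) (rep_gh_space Z)"
          using gh_close_trans[OF gh_close_sym[OF e'(3)] e(3)] .
        then have "gh_dist Y Z < 1 / real (Suc n)"
          unfolding gh_dist_less_iff using e(2) e'(1,2) by (intro exI[of _ "e' + e"]) simp
        then show ?thesis
          using Z(2) unfolding C_def by blast
      qed
      then show ?thesis
        using e(1) by (intro exI[of _ "1 / real (Suc n) - e"] conjI allI impI) simp
    qed
    then have "openin gh_topology (- C n)"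
      unfolding openin_gh_topology by blast
    then show ?thesis
      by (simp add: closedin_def Compl_eq_Diff_UNIV)
  qed
  then show ?thesis
    unfolding eq by (rule fsigma_in_UN_closedin)
qed

lemma closed_imp_gdelta_in_gh: "closedin gh_topology C \<Longrightarrow> gdelta_in gh_topology C"
  unfolding gdelta_in_fsigma_in using open_imp_fsigma_in_gh by (auto simp: closedin_def)

text \<open>Cutting \<open>F\<close> with each open set of a family for \<open>G\<close> yields
  F_sigma sets, because open sets are F_sigma.\<close>

lemma fsigma_delta_in_Int:
  assumes F: "fsigma_in T F" and G: "gdelta_in T G"
    and open_fsigma: "\<And>U. openin T U \<Longrightarrow> fsigma_in T U"
  shows "fsigma_delta_in T (F \<inter> G)"
proof -
  obtain \<U> where \<U>: "countable \<U>" "\<And>U. U \<in> \<U> \<Longrightarrow> openin T U" "\<Inter>\<U> = G"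
    using G unfolding gdelta_in_alt intersection_of_def by blast
  \<comment> \<open>Inserting \<open>F\<close> itself covers the case of an empty family, whose
    intersection is the whole type.\<close>
  have "(countable intersection_of fsigma_in T) (\<Inter>(insert F ((\<inter>) F ` \<U>)))"
    unfolding intersection_of_def
    using \<U> F open_fsigma by (intro exI[of _ "insert F ((\<inter>) F ` \<U>)"]) (auto intro: fsigma_in_Int)
  moreover have "\<Inter>(insert F ((\<inter>) F ` \<U>)) = F \<inter> G"
    using \<U>(3) by auto
  moreover have "F \<inter> G \<subseteq> topspace T"
    using fsigma_in_subset[OF F] by blast
  ultimately show ?thesis
    unfolding fsigma_delta_in_def relative_to_def by (metis inf.absorb_iff2)
qed

text \<open>The dual argument: \<open>G\<close> is distributed over the closed pieces of
  \<open>F\<close>, each of which is G_delta.\<close>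

lemma gdelta_sigma_in_Int:
  assumes F: "fsigma_in T F" and G: "gdelta_in T G"
    and closed_gdelta: "\<And>C. closedin T C \<Longrightarrow> gdelta_in T C"
  shows "gdelta_sigma_in T (F \<inter> G)"
proof -
  obtain \<C> where \<C>: "countable \<C>" "\<And>C. C \<in> \<C> \<Longrightarrow> closedin T C" "\<Union>\<C> = F"
    using F unfolding fsigma_in_def union_of_def by blast
  have "(countable union_of gdelta_in T) (\<Union>((\<lambda>C. C \<inter> G) ` \<C>))"
    unfolding union_of_def
    using \<C> G closed_gdelta by (intro exI[of _ "(\<lambda>C. C \<inter> G) ` \<C>"]) (auto intro: gdelta_in_Int)
  moreover have "\<Union>((\<lambda>C. C \<inter> G) ` \<C>) = F \<inter> G"
    using \<C>(3) by auto
  ultimately show ?thesis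
    by (simp add: gdelta_sigma_in_def)
qed

section \<open>Closed conditions exhausting the three classes\<close>

text \<open>
  A cover of each ball of radius \<open>r\<close> by \<open>N\<close> sets of diameter at most \<open>s * r\<close>, the sets being the
  fibres of a labelling of the points.
\<close>

definition label_cover :: "real \<Rightarrow> nat \<Rightarrow> 'a metric \<Rightarrow> bool" where
  "label_cover s N X \<longleftrightarrow>
     (\<forall>x\<in>mspace X. \<forall>r>0. \<exists>c :: 'a \<Rightarrow> nat. (\<forall>y\<in>mcball_of X x r. c y < N) \<and>
        (\<forall>y\<in>mcball_of X x r. \<forall>z\<in>mcball_of X x r. c y = c z \<longrightarrow> mdist X y z \<le> s * r))"

text \<open>A violation consists of finitely many strict inequalities in a ball whose radius may be
  enlarged slightly, so it survives small changes of the distances.\<close>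

definition packing :: "nat \<Rightarrow> 'a metric \<Rightarrow> bool" where
  "packing N X \<longleftrightarrow>
     (\<forall>x\<in>mspace X. \<forall>r>0. \<forall>S. finite S \<and> S \<subseteq> mcball_of X x r \<and>
        (\<forall>y\<in>S. \<forall>z\<in>S. y \<noteq> z \<longrightarrow> r / 2 < mdist X y z) \<longrightarrow> card S \<le> N)"

lemma doubling_with_iterate:
  assumes "doubling_with N X" "x \<in> mspace X" "r > 0"
  shows "\<exists>F\<subseteq>mspace X. finite F \<and> card F \<le> N ^ k \<and> mcball_of X x r \<subseteq> (\<Union>y\<in>F. mcball_of X y (r / 2 ^ k))"
  using assms(2,3)
proof (induction k arbitrary: x r)
  case 0
  then show ?case
    by (intro exI[of _ "{x}"]) auto
next
  case (Suc k)
  obtain F where F: "F \<subseteq> mspace X" "finite F" "card F \<le> N"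
    "mcball_of X x r \<subseteq> (\<Union>y\<in>F. mcball_of X y (r / 2))"
    using assms(1) Suc.prems unfolding doubling_with_def by metis
  have "\<forall>y\<in>F. \<exists>G\<subseteq>mspace X. finite G \<and> card G \<le> N ^ k \<and>
      mcball_of X y (r / 2) \<subseteq> (\<Union>z\<in>G. mcball_of X z (r / 2 / 2 ^ k))"
    using Suc.IH[of _ "r / 2"] Suc.prems F(1) by auto
  then obtain G where G: "\<And>y. y \<in> F \<Longrightarrow> G y \<subseteq> mspace X \<and> finite (G y) \<and> card (G y) \<le> N ^ k \<and>
      mcball_of X y (r / 2) \<subseteq> (\<Union>z\<in>G y. mcball_of X z (r / 2 / 2 ^ k))"
    by metis
  have "card (\<Union>y\<in>F. G y) \<le> (\<Sum>y\<in>F. card (G y))"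
    by (rule card_UN_le[OF F(2)])
  also have "\<dots> \<le> card F * N ^ k"
    using G sum_bounded_above[of F "\<lambda>y. card (G y)" "N ^ k"] by simp
  also have "\<dots> \<le> N ^ Suc k"
    using F(3) by simp
  finally have "card (\<Union>y\<in>F. G y) \<le> N ^ Suc k" .
  moreover have "mcball_of X x r \<subseteq> (\<Union>z\<in>(\<Union>y\<in>F. G y). mcball_of X z (r / 2 ^ Suc k))"
  proof
    fix w assume "w \<in> mcball_of X x r"
    then obtain y where "y \<in> F" "w \<in> mcball_of X y (r / 2)"
      using F(4) by blast
    then obtain z where "z \<in> G y" "w \<in> mcball_of X z (r / 2 / 2 ^ k)"
      using G by blast
    then show "w \<in> (\<Union>z\<in>(\<Union>y\<in>F. G y). mcball_of X z (r / 2 ^ Suc k))"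
      using \<open>y \<in> F\<close> by (auto simp: field_simps)
  qed
  ultimately show ?case
    using F(2) G by (intro exI[of _ "\<Union>y\<in>F. G y"]) auto
qed

text \<open>Three halvings give balls of radius \<open>r / 8\<close>, hence fibres of diameter at
  most \<open>r / 4\<close>. The fraction 1/4 leaves a factor 2 for products, where the
  contributions of two factors add up.\<close>

lemma doubling_with_imp_label_cover:
  assumes "doubling_with N X"
  shows "label_cover (1 / 4) (N ^ 3) X"
  unfolding label_cover_def
proof (intro ballI allI impI)
  fix x and r :: real assume "x \<in> mspace X" "r > 0"
  then obtain F where F: "F \<subseteq> mspace X" "finite F" "card F \<le> N ^ 3"
    "mcball_of X x r \<subseteq> (\<Union>y\<in>F. mcball_of X y (r / 2 ^ 3))"
    using doubling_with_iterate[OF assms, of x r 3] by blast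
  then have "\<forall>y\<in>mcball_of X x r. \<exists>f\<in>F. y \<in> mcball_of X f (r / 2 ^ 3)"
    by blast
  then obtain f where f: "\<And>y. y \<in> mcball_of X x r \<Longrightarrow> f y \<in> F \<and> y \<in> mcball_of X (f y) (r / 2 ^ 3)"
    by metis
  obtain g :: "'a \<Rightarrow> nat" where g: "bij_betw g F {0..<card F}"
    using ex_bij_betw_finite_nat[OF F(2)] by blast
  show "\<exists>c :: 'a \<Rightarrow> nat. (\<forall>y\<in>mcball_of X x r. c y < N ^ 3) \<and>
        (\<forall>y\<in>mcball_of X x r. \<forall>z\<in>mcball_of X x r. c y = c z \<longrightarrow> mdist X y z \<le> 1 / 4 * r)"
  proof (intro exI[of _ "g \<circ> f"] conjI ballI impI)
    show "(g \<circ> f) y < N ^ 3" if "y \<in> mcball_of X x r" for y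
    proof -
      have "g (f y) \<in> {0..<card F}"
        using f[OF that] g by (meson bij_betwE)
      then show ?thesis
        using F(3) by simp
    qed
    fix y z assume yz: "y \<in> mcball_of X x r" "z \<in> mcball_of X x r" "(g \<circ> f) y = (g \<circ> f) z"
    then have "f y = f z"
      using f g unfolding bij_betw_def by (metis comp_apply inj_onD)
    then have "mdist X y (f y) \<le> r / 8" "mdist X (f y) z \<le> r / 8" "f y \<in> mspace X"
      using f[OF yz(1)] f[OF yz(2)] by (auto simp: mdist_commute)
    then show "mdist X y z \<le> 1 / 4 * r"
      using mdist_triangle[of y X "f y" z] yz by simp
  qed
qed

text \<open>Pigeonhole: a fibre has diameter at most \<open>r / 2\<close> and therefore contains at
  most one point of a separated set.\<close>

lemma label_cover_imp_packing:
  assumes "label_cover (1 / 2) N X"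
  shows "packing N X"
  unfolding packing_def
proof (intro ballI allI impI)
  fix x r S assume "x \<in> mspace X" "0 < (r :: real)"
    and S: "finite S \<and> S \<subseteq> mcball_of X x r \<and> (\<forall>y\<in>S. \<forall>z\<in>S. y \<noteq> z \<longrightarrow> r / 2 < mdist X y z)"
  then obtain c :: "'a \<Rightarrow> nat" where c: "\<forall>y\<in>mcball_of X x r. c y < N"
    "\<forall>y\<in>mcball_of X x r. \<forall>z\<in>mcball_of X x r. c y = c z \<longrightarrow> mdist X y z \<le> 1 / 2 * r"
    using assms unfolding label_cover_def by metis
  have "inj_on c S"
  proof (rule inj_onI, rule ccontr)
    fix y z assume yz: "y \<in> S" "z \<in> S" "c y = c z" "y \<noteq> z"
    then have "mdist X y z \<le> 1 / 2 * r" "r / 2 < mdist X y z"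
      using S c(2) by blast+
    then show False by simp
  qed
  moreover have "c ` S \<subseteq> {..<N}"
    using S c(1) by blast
  ultimately show "card S \<le> N"
    by (metis card_inj_on_le card_lessThan finite_lessThan)
qed

text \<open>A separated set of largest cardinality is a net, since a point far from all its members
  could be added. The bound \<open>N\<close> ensures that a largest one exists.\<close>

lemma packing_imp_doubling_with:
  assumes "packing N X"
  shows "doubling_with N X"
  unfolding doubling_with_def
proof (intro ballI allI impI)
  fix x and r :: real assume xr: "x \<in> mspace X" "r > 0"
  define \<S> where "\<S> S \<longleftrightarrow> finite S \<and> S \<subseteq> mcball_of X x r \<and>
      (\<forall>y\<in>S. \<forall>z\<in>S. y \<noteq> z \<longrightarrow> r / 2 < mdist X y z)" for S
  have bound: "card S \<le> N" if "\<S> S" for S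
    using assms[unfolded packing_def, rule_format, OF xr] that unfolding \<S>_def by simp
  have "\<S> {}"
    by (simp add: \<S>_def)
  moreover have "\<forall>S. \<S> S \<longrightarrow> card S < Suc N"
    using bound by (simp add: less_Suc_eq_le)
  ultimately have "\<exists>S. \<S> S \<and> (\<forall>S'. \<S> S' \<longrightarrow> card S' \<le> card S)"
    by (rule ex_has_greatest_nat)
  then obtain S where S: "\<S> S" "\<And>S'. \<S> S' \<Longrightarrow> card S' \<le> card S"
    by blast
  have "mcball_of X x r \<subseteq> (\<Union>y\<in>S. mcball_of X y (r / 2))"
  proof (rule subsetI, rule ccontr)
    fix w assume w: "w \<in> mcball_of X x r" "w \<notin> (\<Union>y\<in>S. mcball_of X y (r / 2))"
    then have far: "r / 2 < mdist X y w" if "y \<in> S" for y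
      using S(1) that by (auto simp: \<S>_def subset_iff)
    have far': "r / 2 < mdist X w y" if "y \<in> S" for y
      using far[OF that] by (simp add: mdist_commute)
    have "mdist X w w = 0"
      using w(1) by simp
    then have "w \<notin> S"
      using far[of w] xr(2) by auto
    have "\<S> (insert w S)"
      using S(1) w(1) far far' unfolding \<S>_def by simp
    then have "card (insert w S) \<le> card S"
      by (rule S(2))
    then show False
      using \<open>w \<notin> S\<close> S(1) by (simp add: \<S>_def)
  qed
  moreover have "S \<subseteq> mspace X" "finite S"
    using S(1) by (auto simp: \<S>_def)
  ultimately show "\<exists>F\<subseteq>mspace X. finite F \<and> card F \<le> N \<and> mcball_of X x r \<subseteq> (\<Union>y\<in>F. mcball_of X y (r / 2))"
    using bound[OF S(1)] by (intro exI[of _ S] conjI)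
qed

lemma label_cover_mono:
  assumes "label_cover s N X" "s \<le> t"
  shows "label_cover t N X"
  unfolding label_cover_def
proof (intro ballI allI impI)
  fix x and r :: real assume "x \<in> mspace X" "r > 0"
  then obtain c :: "'a \<Rightarrow> nat" where c: "\<forall>y\<in>mcball_of X x r. c y < N"
    "\<forall>y\<in>mcball_of X x r. \<forall>z\<in>mcball_of X x r. c y = c z \<longrightarrow> mdist X y z \<le> s * r"
    using assms(1) unfolding label_cover_def by metis
  have "s * r \<le> t * r"
    using assms(2) \<open>r > 0\<close> by simp
  then have "\<forall>y\<in>mcball_of X x r. \<forall>z\<in>mcball_of X x r. c y = c z \<longrightarrow> mdist X y z \<le> t * r"
    using c(2) order_trans by blast
  with c(1) show "\<exists>c :: 'a \<Rightarrow> nat. (\<forall>y\<in>mcball_of X x r. c y < N) \<and>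
      (\<forall>y\<in>mcball_of X x r. \<forall>z\<in>mcball_of X x r. c y = c z \<longrightarrow> mdist X y z \<le> t * r)"
    by (intro exI[of _ c] conjI)
qed

text \<open>Closes the circle from balls over labels to packings and back. The constant grows from
  \<open>N\<close> to \<open>N ^ 3\<close>, which the existential quantifier absorbs.\<close>

lemma doubling_iff_packing: "doubling X \<longleftrightarrow> (\<exists>N. packing N X)"
proof -
  have "packing (N ^ 3) X" if "doubling_with N X" for N
    by (intro label_cover_imp_packing label_cover_mono[OF doubling_with_imp_label_cover[OF that]]) simp
  then show ?thesis
    unfolding doubling_def using packing_imp_doubling_with by blast
qed

lemma doubling_imp_label_cover: "doubling X \<Longrightarrow> \<exists>N. label_cover (1 / 4) N X"
  unfolding doubling_def using doubling_with_imp_label_cover by blast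

lemma label_cover_imp_doubling: "label_cover (1 / 2) N X \<Longrightarrow> doubling X"
  unfolding doubling_iff_packing using label_cover_imp_packing by blast

lemma not_packing_stable:
  fixes X :: "'a metric"
  assumes "\<not> packing N X"
  shows "\<exists>e>0. \<forall>(Y :: 'b metric) e'. 0 < e' \<longrightarrow> e' < e \<longrightarrow> gh_close e' X Y \<longrightarrow> \<not> packing N Y"
proof -
  obtain x r S where x: "x \<in> mspace X" "r > 0" and S: "finite S" "S \<subseteq> mcball_of X x r"
    "\<And>y z. \<lbrakk>y \<in> S; z \<in> S; y \<noteq> z\<rbrakk> \<Longrightarrow> r / 2 < mdist X y z" and card: "N < card S"
    using assms unfolding packing_def by (auto simp: not_le)
  define D where "D = (\<lambda>(y, z). mdist X y z - r / 2) ` {(y, z) \<in> S \<times> S. y \<noteq> z}"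
  have D: "finite D" "\<And>d. d \<in> D \<Longrightarrow> 0 < d"
    using S by (auto simp: D_def intro!: finite_subset[OF _ finite_cartesian_product[OF S(1) S(1)]])
  \<comment> \<open>Distances shrink by at most \<open>2 * e'\<close>, and enlarging the radius to
    \<open>r + 2 * e'\<close> raises the required separation by \<open>e'\<close>; together this
    uses \<open>3 * e'\<close> of the least slack. The inserted 1 keeps the minimum defined when
    \<open>D\<close> is empty.\<close>
  define e where "e = Min (insert 1 D) / 3"
  have "e > 0"
    using D by (auto simp: e_def)
  have e: "3 * e \<le> mdist X y z - r / 2" if "y \<in> S" "z \<in> S" "y \<noteq> z" for y z
  proof -
    have "mdist X y z - r / 2 \<in> D"
      using that by (auto simp: D_def intro!: image_eqI[where x = "(y, z)"])
    then have "Min (insert 1 D) \<le> mdist X y z - r / 2"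
      using D(1) by (intro Min_le) auto
    then show ?thesis
      by (simp add: e_def)
  qed
  have "\<not> packing N Y" if e': "0 < e'" "e' < e" "gh_close e' X Y" for Y :: "'b metric" and e'
  proof -
    obtain f where f: "\<forall>x\<in>mspace X. f x \<in> mspace Y"
      "\<forall>x\<in>mspace X. \<forall>x'\<in>mspace X. \<bar>mdist X x x' - mdist Y (f x) (f x')\<bar> \<le> 2 * e'"
      using gh_close_map[OF e'(3)] by blast
    have SX: "y \<in> mspace X" "mdist X x y \<le> r" if "y \<in> S" for y
      using S(2) that by auto
    have close: "\<bar>mdist X y z - mdist Y (f y) (f z)\<bar> \<le> 2 * e'" if "y \<in> mspace X" "z \<in> mspace X" for y z
      using f(2) that by blast
    have sep: "(r + 2 * e') / 2 < mdist Y (f y) (f z)" if "y \<in> S" "z \<in> S" "y \<noteq> z" for y z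
      using close[OF SX(1)[OF that(1)] SX(1)[OF that(2)]] e[OF that] e' by (simp add: abs_le_iff)
    have "inj_on f S"
    proof (rule inj_onI, rule ccontr)
      fix y z assume yz: "y \<in> S" "z \<in> S" "f y = f z" "y \<noteq> z"
      then have "mdist Y (f y) (f z) = 0"
        using f(1) SX by simp
      then show False
        using sep[OF yz(1,2,4)] x(2) e' by simp
    qed
    then have card': "N < card (f ` S)"
      using card by (simp add: card_image)
    have ball: "f ` S \<subseteq> mcball_of Y (f x) (r + 2 * e')"
    proof clarify
      fix y assume y: "y \<in> S"
      have "mdist Y (f x) (f y) \<le> r + 2 * e'"
        using close[OF x(1) SX(1)[OF y]] SX(2)[OF y] by linarith
      then show "f y \<in> mcball_of Y (f x) (r + 2 * e')"
        using SX(1)[OF y] f(1) x(1) by simp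
    qed
    have sep': "\<forall>a\<in>f ` S. \<forall>b\<in>f ` S. a \<noteq> b \<longrightarrow> (r + 2 * e') / 2 < mdist Y a b"
      using sep by auto
    show ?thesis
    proof
      assume "packing N Y"
      moreover have "f x \<in> mspace Y" "0 < r + 2 * e'" "finite (f ` S)"
        using f(1) x e'(1) S(1) by auto
      ultimately have "card (f ` S) \<le> N"
        using ball sep' unfolding packing_def by blast
      then show False
        using card' by simp
    qed
  qed
  then show ?thesis
    by (intro exI[of _ e] conjI allI impI \<open>e > 0\<close>)
qed

section \<open>Uniform disconnectedness, by chains\<close>

definition chain_disconnected :: "real \<Rightarrow> 'a metric \<Rightarrow> bool" where
  "chain_disconnected \<delta> X \<longleftrightarrow>
     (\<forall>n z t. 0 \<le> t \<and> (\<forall>i\<le>n. z i \<in> mspace X) \<and> (\<forall>i<n. mdist X (z i) (z (Suc i)) \<le> t) \<longrightarrow>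
        \<delta> * mdist X (z 0) (z n) \<le> t)"

text \<open>The bound \<open>t\<close> replaces the maximum of the steps, so chains that are
  constant or consist of one point become harmless: equal end points are at distance 0, and
  \<open>0 \<le> t\<close>. Conversely, \<open>t\<close> is taken to be the maximum.\<close>

lemma uniformly_disconnected_with_iff_chain:
  "uniformly_disconnected_with \<delta> X \<longleftrightarrow> chain_disconnected \<delta> X"
proof
  assume ud: "uniformly_disconnected_with \<delta> X"
  show "chain_disconnected \<delta> X"
    unfolding chain_disconnected_def
  proof (intro allI impI)
    fix n and z :: "nat \<Rightarrow> 'a" and t :: real
    assume z: "0 \<le> t \<and> (\<forall>i\<le>n. z i \<in> mspace X) \<and> (\<forall>i<n. mdist X (z i) (z (Suc i)) \<le> t)"
    show "\<delta> * mdist X (z 0) (z n) \<le> t"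
    proof (cases "z 0 = z n")
      case True
      then have "mdist X (z 0) (z n) = 0"
        using z by simp
      then show ?thesis
        using z by (metis mult_zero_right)
    next
      case False
      then have "n \<ge> 1"
        by (cases n) auto
      \<comment> \<open>Shifts the indices from 0, ..., n to 1, ..., n + 1; the truncated
        subtraction at 0 lies outside the range.\<close>
      define y where "y i = z (i - 1)" for i
      have "\<forall>i\<in>{1..Suc n}. y i \<in> mspace X"
        using z by (auto simp: y_def)
      moreover have "\<exists>i\<in>{1..Suc n}. \<exists>j\<in>{1..Suc n}. y i \<noteq> y j"
        using False by (intro bexI[of _ 1] bexI[of _ "Suc n"]) (auto simp: y_def)
      ultimately have "\<delta> * mdist X (y 1) (y (Suc n)) \<le> Max ((\<lambda>i. mdist X (y i) (y (i + 1))) ` {1..Suc n - 1})"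
        using ud unfolding uniformly_disconnected_with_def by blast
      also have "\<dots> \<le> t"
      proof (rule Max.boundedI)
        fix a assume "a \<in> (\<lambda>i. mdist X (y i) (y (i + 1))) ` {1..Suc n - 1}"
        then obtain i where "1 \<le> i" "i \<le> n" "a = mdist X (z (i - 1)) (z i)"
          by (auto simp: y_def)
        moreover have "mdist X (z (i - 1)) (z (Suc (i - 1))) \<le> t"
          using z \<open>1 \<le> i\<close> \<open>i \<le> n\<close> by (intro z[THEN conjunct2, THEN conjunct2, rule_format]) simp
        ultimately show "a \<le> t"
          by simp
      qed (use \<open>n \<ge> 1\<close> in auto)
      finally show ?thesis
        by (simp add: y_def)
    qed
  qed
next
  assume chain: "chain_disconnected \<delta> X"
  show "uniformly_disconnected_with \<delta> X"
    unfolding uniformly_disconnected_with_def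
  proof (intro allI impI)
    fix N and z :: "nat \<Rightarrow> 'a"
    assume z: "(\<forall>i\<in>{1..N}. z i \<in> mspace X) \<and> (\<exists>i\<in>{1..N}. \<exists>j\<in>{1..N}. z i \<noteq> z j)"
    then have "N \<ge> 2"
      by (metis atLeastAtMost_iff le_antisym not_less_eq_eq numeral_2_eq_2 order_trans One_nat_def)
    let ?M = "(\<lambda>i. mdist X (z i) (z (i + 1))) ` {1..N - 1}"
    have le: "mdist X (z i) (z (i + 1)) \<le> Max ?M" if "1 \<le> i" "i \<le> N - 1" for i
      using that by (intro Max_ge) auto
    have "0 \<le> mdist X (z 1) (z (1 + 1))"
      by simp
    also have "\<dots> \<le> Max ?M"
      using le[of 1] \<open>N \<ge> 2\<close> by simp
    finally have "0 \<le> Max ?M" .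
    moreover have "\<forall>i\<le>N - 1. z (Suc i) \<in> mspace X"
      using z \<open>N \<ge> 2\<close> by auto
    moreover have "\<forall>i<N - 1. mdist X (z (Suc i)) (z (Suc (Suc i))) \<le> Max ?M"
      using le[of "Suc _"] by auto
    ultimately have "\<delta> * mdist X (z (Suc 0)) (z (Suc (N - 1))) \<le> Max ?M"
      using chain[unfolded chain_disconnected_def, rule_format, of "Max ?M" "N - 1" "\<lambda>i. z (Suc i)"] by blast
    then show "\<delta> * mdist X (z 1) (z N) \<le> Max ?M"
      using \<open>N \<ge> 2\<close> by simp
  qed
qed

lemma chain_disconnected_mono:
  assumes "chain_disconnected \<delta> X" "\<delta>' \<le> \<delta>"
  shows "chain_disconnected \<delta>' X"
  unfolding chain_disconnected_def
proof (intro allI impI)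
  fix n and z :: "nat \<Rightarrow> 'a" and t :: real
  assume z: "0 \<le> t \<and> (\<forall>i\<le>n. z i \<in> mspace X) \<and> (\<forall>i<n. mdist X (z i) (z (Suc i)) \<le> t)"
  have "\<delta>' * mdist X (z 0) (z n) \<le> \<delta> * mdist X (z 0) (z n)"
    using assms(2) by (simp add: mult_right_mono)
  also have "\<dots> \<le> t"
    using assms(1) z unfolding chain_disconnected_def by blast
  finally show "\<delta>' * mdist X (z 0) (z n) \<le> t" .
qed

lemma uniformly_disconnected_iff_chain:
  "uniformly_disconnected X \<longleftrightarrow> (\<exists>\<delta>>0. chain_disconnected \<delta> X)"
  by (simp add: uniformly_disconnected_def uniformly_disconnected_with_iff_chain)

lemma not_chain_disconnected_stable:
  fixes X :: "'a metric"
  assumes "\<not> chain_disconnected \<delta> X" "\<delta> > 0"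
  shows "\<exists>e>0. \<forall>(Y :: 'b metric) e'. 0 < e' \<longrightarrow> e' < e \<longrightarrow> gh_close e' X Y \<longrightarrow> \<not> chain_disconnected \<delta> Y"
proof -
  obtain n z t where t: "0 \<le> t" and z: "\<And>i. i \<le> n \<Longrightarrow> z i \<in> mspace X"
    "\<And>i. i < n \<Longrightarrow> mdist X (z i) (z (Suc i)) \<le> t" and less: "t < \<delta> * mdist X (z 0) (z n)"
    using assms(1) unfolding chain_disconnected_def by (auto simp: not_le)
  \<comment> \<open>Each step grows by at most \<open>2 * e'\<close> and the end distance shrinks by
    at most \<open>2 * e'\<close>, so the violation loses at most
    \<open>2 * (1 + \<delta>) * e'\<close>.\<close>
  define e where "e = (\<delta> * mdist X (z 0) (z n) - t) / (2 * (1 + \<delta>))"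
  have e: "e > 0" "2 * (1 + \<delta>) * e = \<delta> * mdist X (z 0) (z n) - t"
    using less \<open>\<delta> > 0\<close> by (auto simp: e_def)
  have "\<not> chain_disconnected \<delta> Y" if e': "0 < e'" "e' < e" "gh_close e' X Y" for Y :: "'b metric" and e'
  proof
    obtain f where f: "\<forall>x\<in>mspace X. f x \<in> mspace Y"
      "\<forall>x\<in>mspace X. \<forall>x'\<in>mspace X. \<bar>mdist X x x' - mdist Y (f x) (f x')\<bar> \<le> 2 * e'"
      using gh_close_map[OF e'(3)] by blast
    assume chain: "chain_disconnected \<delta> Y"
    have "\<delta> * mdist Y (f (z 0)) (f (z n)) \<le> t + 2 * e'"
    proof (rule chain[unfolded chain_disconnected_def, rule_format, of "t + 2 * e'" n "f \<circ> z", simplified], intro conjI allI impI)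
      fix i assume "i < n"
      then have "\<bar>mdist X (z i) (z (Suc i)) - mdist Y (f (z i)) (f (z (Suc i)))\<bar> \<le> 2 * e'"
        using f(2) z(1) by simp
      then show "mdist Y (f (z i)) (f (z (Suc i))) \<le> t + 2 * e'"
        using z(2)[OF \<open>i < n\<close>] by linarith
    qed (use t e' f(1) z(1) in auto)
    moreover have "mdist X (z 0) (z n) - 2 * e' \<le> mdist Y (f (z 0)) (f (z n))"
      using f(2) z(1)[of 0] z(1)[of n] by (fastforce simp: abs_le_iff)
    then have "\<delta> * (mdist X (z 0) (z n) - 2 * e') \<le> \<delta> * mdist Y (f (z 0)) (f (z n))"
      using \<open>\<delta> > 0\<close> by (intro mult_left_mono) auto
    ultimately have "\<delta> * mdist X (z 0) (z n) - t \<le> 2 * (1 + \<delta>) * e'"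
      by (simp add: algebra_simps)
    also have "\<dots> < 2 * (1 + \<delta>) * e"
      using e'(2) \<open>\<delta> > 0\<close> by simp
    finally show False
      using e(2) by simp
  qed
  then show ?thesis
    by (intro exI[of _ e] conjI allI impI e(1))
qed

section \<open>Uniform perfectness, with slack\<close>

text \<open>
  The slack \<open>\<epsilon>\<close> makes this condition closed under limits without an appeal to compactness; it
  costs only a constant factor in \<open>c\<close>.
\<close>

definition almost_perfect :: "real \<Rightarrow> 'a metric \<Rightarrow> bool" where
  "almost_perfect c X \<longleftrightarrow>
     (\<forall>x\<in>mspace X. \<forall>r>0. (\<exists>p\<in>mspace X. \<exists>q\<in>mspace X. r < mdist X p q) \<longrightarrow>
        (\<forall>\<epsilon>>0. \<exists>y\<in>mspace X. c * r - \<epsilon> \<le> mdist X x y \<and> mdist X x y \<le> r + \<epsilon>))"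

text \<open>Replaces comparison with a supremum by a witnessing pair, the form that survives
  perturbation. Compactness makes the set of distances bounded.\<close>

lemma less_metric_diameter_iff:
  assumes "nonempty_compact_metric X"
  shows "r < metric_diameter X \<longleftrightarrow> (\<exists>p\<in>mspace X. \<exists>q\<in>mspace X. r < mdist X p q)"
proof -
  let ?S = "{mdist X x y | x y. x \<in> mspace X \<and> y \<in> mspace X}"
  obtain D where "\<forall>x\<in>mspace X. \<forall>y\<in>mspace X. mdist X x y \<le> D"
    using mdist_bounded[OF assms] by blast
  then have "bdd_above ?S"
    by (auto intro!: bdd_aboveI[where M = D])
  moreover have "?S \<noteq> {}"
    using assms by (auto simp: nonempty_compact_metric_def)
  ultimately have "r < Sup ?S \<longleftrightarrow> (\<exists>a\<in>?S. r < a)"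
    by (intro less_cSup_iff)
  then show ?thesis
    unfolding metric_diameter_def by blast
qed

lemma uniformly_perfect_with_imp_almost_perfect:
  assumes "nonempty_compact_metric X" "uniformly_perfect_with c X" "c' \<le> c"
  shows "almost_perfect c' X"
  unfolding almost_perfect_def
proof (intro ballI allI impI)
  fix x and r \<epsilon> :: real
  assume x: "x \<in> mspace X" and r: "0 < r" "\<exists>p\<in>mspace X. \<exists>q\<in>mspace X. r < mdist X p q" and "0 < \<epsilon>"
  then have "r \<in> {0<..<metric_diameter X}"
    using less_metric_diameter_iff[OF assms(1)] by simp
  then obtain y where y: "y \<in> mspace X" "c * r \<le> mdist X x y" "mdist X x y \<le> r"
    using assms(2) x unfolding uniformly_perfect_with_def by blast
  moreover have "c' * r \<le> c * r"
    using assms(3) r by simp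
  ultimately show "\<exists>y\<in>mspace X. c' * r - \<epsilon> \<le> mdist X x y \<and> mdist X x y \<le> r + \<epsilon>"
    using \<open>0 < \<epsilon>\<close> by (intro bexI[of _ y]) auto
qed

lemma almost_perfect_imp_uniformly_perfect:
  assumes "nonempty_compact_metric X" "almost_perfect c X" "0 < c" "c < 1"
  shows "uniformly_perfect X"
  unfolding uniformly_perfect_def
proof (rule bexI[of _ "c / 4"])
  show "uniformly_perfect_with (c / 4) X"
    unfolding uniformly_perfect_with_def
  proof (intro ballI)
    fix x r assume x: "x \<in> mspace X" and r: "r \<in> {0<..<metric_diameter X}"
    then obtain p q where "p \<in> mspace X" "q \<in> mspace X" "r < mdist X p q"
      using less_metric_diameter_iff[OF assms(1)] by auto
    then have "\<exists>p\<in>mspace X. \<exists>q\<in>mspace X. r / 2 < mdist X p q"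
      using r by (intro bexI[of _ p] bexI[of _ q]) auto
    \<comment> \<open>Radius \<open>r / 2\<close> with slack \<open>c * r / 4\<close>: half of the
      lower bound survives, and the upper bound stays below \<open>r\<close> because
      \<open>c < 1\<close>.\<close>
    then obtain y where y: "y \<in> mspace X" "c * (r / 2) - c * r / 4 \<le> mdist X x y" "mdist X x y \<le> r / 2 + c * r / 4"
      using assms(2,3) x r unfolding almost_perfect_def
      by (metis divide_pos_pos greaterThanLessThan_iff mult_pos_pos zero_less_numeral)
    have "c * r / 4 \<le> r / 2"
      using \<open>c < 1\<close> r by (simp add: mult_le_cancel_right1 field_simps)
    then have "mdist X x y \<le> r"
      using y(3) by linarith
    moreover have "c / 4 * r \<le> mdist X x y"
      using y(2) by (simp add: field_simps)
    ultimately show "\<exists>y\<in>mspace X. c / 4 * r \<le> mdist X x y \<and> mdist X x y \<le> r"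
      using y(1) by blast
  qed
qed (use assms in auto)

text \<open>The constants tend to 0, so they undercut any given \<open>c\<close>; the offset 2 keeps
  every one of them strictly below 1.\<close>

lemma uniformly_perfect_iff_almost_perfect:
  assumes "nonempty_compact_metric X"
  shows "uniformly_perfect X \<longleftrightarrow> (\<exists>n :: nat. almost_perfect (1 / (real n + 2)) X)"
proof
  assume "uniformly_perfect X"
  then obtain c where c: "0 < c" "uniformly_perfect_with c X"
    by (auto simp: uniformly_perfect_def)
  obtain n where "1 / real (Suc n) < c"
    using nat_approx_posE[OF c(1)] .
  moreover have "1 / (real n + 2) \<le> 1 / real (Suc n)"
    by (simp add: field_simps)
  ultimately show "\<exists>n :: nat. almost_perfect (1 / (real n + 2)) X"
    using uniformly_perfect_with_imp_almost_perfect[OF assms c(2)] by (intro exI[of _ n]) simp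
next
  assume "\<exists>n :: nat. almost_perfect (1 / (real n + 2)) X"
  then show "uniformly_perfect X"
    using almost_perfect_imp_uniformly_perfect[OF assms] by fastforce
qed

lemma not_almost_perfect_stable:
  fixes X :: "'a metric"
  assumes "\<not> almost_perfect c X"
  shows "\<exists>e>0. \<forall>(Y :: 'b metric) e'. 0 < e' \<longrightarrow> e' < e \<longrightarrow> gh_close e' X Y \<longrightarrow> \<not> almost_perfect c Y"
proof -
  obtain x r \<epsilon> p q where x: "x \<in> mspace X" "0 < r" "p \<in> mspace X" "q \<in> mspace X" "r < mdist X p q" "0 < \<epsilon>"
    and none: "\<And>y. \<lbrakk>y \<in> mspace X; c * r - \<epsilon> \<le> mdist X x y; mdist X x y \<le> r + \<epsilon>\<rbrakk> \<Longrightarrow> False"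
    using assms unfolding almost_perfect_def by blast
  \<comment> \<open>The first term keeps \<open>2 * e'\<close> below \<open>\<epsilon> / 2\<close>,
    so that half of the slack remains for \<open>Y\<close>; the second keeps the images of
    \<open>p\<close> and \<open>q\<close> more than \<open>r\<close> apart.\<close>
  define e where "e = min (\<epsilon> / 4) ((mdist X p q - r) / 2)"
  have "e > 0"
    using x by (simp add: e_def)
  have "\<not> almost_perfect c Y" if e': "0 < e'" "e' < e" "gh_close e' X Y" for Y :: "'b metric" and e'
  proof
    obtain f where f: "\<forall>x\<in>mspace X. f x \<in> mspace Y"
      "\<forall>x\<in>mspace X. \<forall>x'\<in>mspace X. \<bar>mdist X x x' - mdist Y (f x) (f x')\<bar> \<le> 2 * e'"
      "\<forall>y\<in>mspace Y. \<exists>x\<in>mspace X. \<forall>x'\<in>mspace X. \<bar>mdist X x' x - mdist Y (f x') y\<bar> \<le> 2 * e'"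
      using gh_close_map[OF e'(3)] by blast
    assume "almost_perfect c Y"
    moreover have "f x \<in> mspace Y" "f p \<in> mspace Y" "f q \<in> mspace Y"
      using f(1) x by auto
    moreover have "r < mdist Y (f p) (f q)"
    proof -
      have "\<bar>mdist X p q - mdist Y (f p) (f q)\<bar> \<le> 2 * e'"
        using f(2) x by blast
      then show ?thesis
        using e'(2) by (auto simp: e_def)
    qed
    moreover have "\<epsilon> / 2 > 0"
      using x by simp
    ultimately obtain y where y: "y \<in> mspace Y" "c * r - \<epsilon> / 2 \<le> mdist Y (f x) y" "mdist Y (f x) y \<le> r + \<epsilon> / 2"
      using x(2) unfolding almost_perfect_def by meson
    \<comment> \<open>\<open>y\<close> may lie outside the range of \<open>f\<close>; a
      corresponding point \<open>w\<close> then violates the choice of \<open>x\<close> and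
      \<open>r\<close>, its error using up the other half of the slack.\<close>
    obtain w where w: "w \<in> mspace X" "\<bar>mdist X x w - mdist Y (f x) y\<bar> \<le> 2 * e'"
      using f(3) y(1) x(1) by blast
    have "2 * e' < \<epsilon> / 2"
      using e'(2) by (auto simp: e_def)
    then show False
      using none[OF w(1)] w(2) y(2,3) by (auto simp: abs_le_iff)
  qed
  then show ?thesis
    by (intro exI[of _ e] conjI allI impI \<open>e > 0\<close>)
qed

section \<open>The three classes as countable unions of closed sets\<close>

lemma fsigma_in_doubling: "fsigma_in gh_topology \<Q>\<^sub>1"
proof -
  have eq: "\<Q>\<^sub>1 = (\<Union>N. {X. packing N (rep_gh_space X)})"
    by (auto simp: \<Q>\<^sub>1_def gh_doubling.rep_eq doubling_iff_packing)
  show ?thesis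
    unfolding eq by (intro fsigma_in_UN_closedin closedin_gh_topologyI not_packing_stable)
qed

lemma fsigma_in_uniformly_disconnected: "fsigma_in gh_topology \<Q>\<^sub>2"
proof -
  have "uniformly_disconnected X \<longleftrightarrow> (\<exists>n. chain_disconnected (1 / real (Suc n)) X)" for X :: "real metric"
  proof
    assume "uniformly_disconnected X"
    then obtain \<delta> where \<delta>: "\<delta> > 0" "chain_disconnected \<delta> X"
      unfolding uniformly_disconnected_iff_chain by blast
    obtain n where "1 / real (Suc n) < \<delta>"
      using nat_approx_posE[OF \<delta>(1)] .
    then show "\<exists>n. chain_disconnected (1 / real (Suc n)) X"
      using chain_disconnected_mono[OF \<delta>(2)] less_imp_le by blast
  next
    assume "\<exists>n. chain_disconnected (1 / real (Suc n)) X"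
    then obtain n where "chain_disconnected (1 / real (Suc n)) X" ..
    moreover have "1 / real (Suc n) > 0"
      by simp
    ultimately show "uniformly_disconnected X"
      unfolding uniformly_disconnected_iff_chain by blast
  qed
  then have eq: "\<Q>\<^sub>2 = (\<Union>n. {X. chain_disconnected (1 / real (Suc n)) (rep_gh_space X)})"
    by (auto simp: \<Q>\<^sub>2_def gh_uniformly_disconnected.rep_eq)
  show ?thesis
    unfolding eq by (intro fsigma_in_UN_closedin closedin_gh_topologyI not_chain_disconnected_stable) auto
qed

lemma fsigma_in_uniformly_perfect: "fsigma_in gh_topology \<Q>\<^sub>3"
proof -
  have eq: "\<Q>\<^sub>3 = (\<Union>n :: nat. {X. almost_perfect (1 / (real n + 2)) (rep_gh_space X)})"
    by (auto simp: \<Q>\<^sub>3_def gh_uniformly_perfect.rep_eq uniformly_perfect_iff_almost_perfect rep_gh_space_compact)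
  show ?thesis
    unfolding eq by (intro fsigma_in_UN_closedin closedin_gh_topologyI not_almost_perfect_stable)
qed

section \<open>Products, finite spaces, intervals and Cantor spaces\<close>

lemma mdist_self [simp]: "x \<in> mspace X \<Longrightarrow> mdist X x x = 0"
  using mdist_zero[of x X x] by blast

lemma nonempty_compact_metric_prod:
  assumes "nonempty_compact_metric X" "nonempty_compact_metric Y"
  shows "nonempty_compact_metric (prod_metric X Y)"
  using assms by (simp add: nonempty_compact_metric_def mtopology_of_prod_metric compact_space_prod_topology)

lemma nonempty_compact_metric_submetric:
  assumes "compactin (mtopology_of X) S" "S \<noteq> {}"
  shows "nonempty_compact_metric (submetric X S)"
proof -
  have "S \<subseteq> mspace X"
    using compactin_subset_topspace[OF assms(1)] by simp
  then show ?thesis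
    using assms compact_space_subtopology[OF assms(1)]
    by (simp add: nonempty_compact_metric_def mtopology_of_submetric inf.absorb1)
qed

text \<open>The product metric is the Euclidean combination of its factors. Lying between maximum
  and sum is what the covering and chain estimates use of it.\<close>

lemma mdist_prod_metric_bounds:
  assumes "p \<in> mspace (prod_metric X Y)" "q \<in> mspace (prod_metric X Y)"
  shows "mdist X (fst p) (fst q) \<le> mdist (prod_metric X Y) p q"
    and "mdist Y (snd p) (snd q) \<le> mdist (prod_metric X Y) p q"
    and "mdist (prod_metric X Y) p q \<le> mdist X (fst p) (fst q) + mdist Y (snd p) (snd q)"
proof -
  obtain x y x' y' where pq: "p = (x, y)" "q = (x', y')"
    by (metis surj_pair)
  note * = Metric_space12_mspace_mdist[of X Y]
  show "mdist X (fst p) (fst q) \<le> mdist (prod_metric X Y) p q"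
    "mdist Y (snd p) (snd q) \<le> mdist (prod_metric X Y) p q"
    using Metric_space12.component_le_prod_metric[OF *] by (simp_all add: pq)
  show "mdist (prod_metric X Y) p q \<le> mdist X (fst p) (fst q) + mdist Y (snd p) (snd q)"
    using Metric_space12.prod_metric_le_components[OF *, of x x' y y'] assms by (simp add: pq)
qed

lemma isometric_embedding_Pair_left:
  assumes "x0 \<in> mspace X"
  shows "isometric_embedding Y (prod_metric X Y) (\<lambda>y. (x0, y))"
  using assms by (simp add: isometric_embedding_def prod_dist_def)

lemma isometric_embedding_Pair_right:
  assumes "y0 \<in> mspace Y"
  shows "isometric_embedding X (prod_metric X Y) (\<lambda>x. (x, y0))"
  using assms by (simp add: isometric_embedding_def prod_dist_def)

lemma isometric_embedding_submetric: "isometric_embedding (submetric X S) X (\<lambda>x. x)"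
  by (simp add: isometric_embedding_def)

section \<open>Doubling for subspaces, products, finite spaces and intervals\<close>

lemma label_cover_embedding:
  assumes f: "isometric_embedding X Y f" and Y: "label_cover s N Y"
  shows "label_cover s N X"
  unfolding label_cover_def
proof (intro ballI allI impI)
  fix x and r :: real assume x: "x \<in> mspace X" and r: "r > 0"
  have fY: "f z \<in> mspace Y" if "z \<in> mspace X" for z
    using f that by (auto simp: isometric_embedding_def)
  have dist: "mdist Y (f y) (f z) = mdist X y z" if "y \<in> mspace X" "z \<in> mspace X" for y z
    using f that by (simp add: isometric_embedding_def)
  obtain c :: "'b \<Rightarrow> nat" where c: "\<forall>y\<in>mcball_of Y (f x) r. c y < N"
    "\<forall>y\<in>mcball_of Y (f x) r. \<forall>z\<in>mcball_of Y (f x) r. c y = c z \<longrightarrow> mdist Y y z \<le> s * r"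
    using Y[unfolded label_cover_def, rule_format, OF fY[OF x] r] by blast
  have ball: "f y \<in> mcball_of Y (f x) r" if "y \<in> mcball_of X x r" for y
    using that fY dist by simp
  show "\<exists>c :: 'a \<Rightarrow> nat. (\<forall>y\<in>mcball_of X x r. c y < N) \<and>
      (\<forall>y\<in>mcball_of X x r. \<forall>z\<in>mcball_of X x r. c y = c z \<longrightarrow> mdist X y z \<le> s * r)"
  \<comment> \<open>Labels simply pull back, whereas the centres of covering balls might lie outside
    the range of \<open>f\<close>.\<close>
  proof (intro exI[of _ "c \<circ> f"] conjI ballI impI)
    show "(c \<circ> f) y < N" if "y \<in> mcball_of X x r" for y
      using c(1) ball[OF that] by simp
    fix y z assume yz: "y \<in> mcball_of X x r" "z \<in> mcball_of X x r" "(c \<circ> f) y = (c \<circ> f) z"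
    then have "mdist Y (f y) (f z) \<le> s * r"
      using c(2) ball by simp
    then show "mdist X y z \<le> s * r"
      using yz dist by simp
  qed
qed

lemma doubling_embedding: "\<lbrakk>isometric_embedding X Y f; doubling Y\<rbrakk> \<Longrightarrow> doubling X"
proof -
  assume f: "isometric_embedding X Y f" and "doubling Y"
  then obtain N where N: "label_cover (1 / 4) N Y"
    using doubling_imp_label_cover by blast
  show "doubling X"
    by (rule label_cover_imp_doubling, rule label_cover_mono[OF label_cover_embedding[OF f N]]) simp
qed

text \<open>A ball projects into balls of the same radius, and pairs of labels cover it: two fibres
  of diameter \<open>r / 4\<close> combine to at most \<open>r / 2\<close>.\<close>

lemma doubling_prod:
  assumes "doubling X" "doubling Y"
  shows "doubling (prod_metric X Y)"
proof -
  obtain M where M: "label_cover (1 / 4) M X"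
    using doubling_imp_label_cover[OF assms(1)] by blast
  obtain N where N: "label_cover (1 / 4) N Y"
    using doubling_imp_label_cover[OF assms(2)] by blast
  let ?P = "prod_metric X Y"
  have "label_cover (1 / 2) (M * N) ?P"
    unfolding label_cover_def
  proof (intro ballI allI impI)
    fix p and r :: real assume p: "p \<in> mspace ?P" and r: "r > 0"
    then have p': "fst p \<in> mspace X" "snd p \<in> mspace Y"
      by auto
    obtain c :: "'a \<Rightarrow> nat" where c: "\<forall>y\<in>mcball_of X (fst p) r. c y < M"
      "\<forall>y\<in>mcball_of X (fst p) r. \<forall>z\<in>mcball_of X (fst p) r. c y = c z \<longrightarrow> mdist X y z \<le> 1 / 4 * r"
      using M[unfolded label_cover_def, rule_format, OF p'(1) r] by blast
    obtain d :: "'b \<Rightarrow> nat" where d: "\<forall>y\<in>mcball_of Y (snd p) r. d y < N"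
      "\<forall>y\<in>mcball_of Y (snd p) r. \<forall>z\<in>mcball_of Y (snd p) r. d y = d z \<longrightarrow> mdist Y y z \<le> 1 / 4 * r"
      using N[unfolded label_cover_def, rule_format, OF p'(2) r] by blast
    have ball: "fst q \<in> mcball_of X (fst p) r" "snd q \<in> mcball_of Y (snd p) r" "q \<in> mspace ?P"
      if "q \<in> mcball_of ?P p r" for q
    proof -
      have q: "q \<in> mspace ?P" "mdist ?P p q \<le> r"
        using that by (simp_all del: mdist_prod_metric)
      then show "fst q \<in> mcball_of X (fst p) r" "snd q \<in> mcball_of Y (snd p) r" "q \<in> mspace ?P"
        using mdist_prod_metric_bounds(1,2)[OF p q(1)] p' by auto
    qed
    have cd: "c (fst q) < M" "d (snd q) < N" if "q \<in> mcball_of ?P p r" for q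
      using ball[OF that] c(1) d(1) by blast+
    show "\<exists>c :: 'a \<times> 'b \<Rightarrow> nat. (\<forall>y\<in>mcball_of ?P p r. c y < M * N) \<and>
        (\<forall>y\<in>mcball_of ?P p r. \<forall>z\<in>mcball_of ?P p r. c y = c z \<longrightarrow> mdist ?P y z \<le> 1 / 2 * r)"
    \<comment> \<open>The pair of labels is coded as a two-digit number with last digit below
      \<open>N\<close>, to be decoded by \<open>div\<close> and \<open>mod\<close>.\<close>
    proof (intro exI[of _ "\<lambda>q. c (fst q) * N + d (snd q)"] conjI ballI impI)
      fix q assume q: "q \<in> mcball_of ?P p r"
      have "c (fst q) * N + d (snd q) < (c (fst q) + 1) * N"
        using cd(2)[OF q] by simp
      also have "\<dots> \<le> M * N"
        using cd(1)[OF q] by (intro mult_right_mono) auto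
      finally show "c (fst q) * N + d (snd q) < M * N" .
      fix q' assume q': "q' \<in> mcball_of ?P p r"
        and eq: "c (fst q) * N + d (snd q) = c (fst q') * N + d (snd q')"
      have "d (snd q) = (c (fst q) * N + d (snd q)) mod N" "c (fst q) = (c (fst q) * N + d (snd q)) div N"
        "d (snd q') = (c (fst q') * N + d (snd q')) mod N" "c (fst q') = (c (fst q') * N + d (snd q')) div N"
        using cd(2)[OF q] cd(2)[OF q'] by simp_all
      then have "d (snd q) = d (snd q')" "c (fst q) = c (fst q')"
        using eq by metis+
      then have "mdist X (fst q) (fst q') \<le> 1 / 4 * r" "mdist Y (snd q) (snd q') \<le> 1 / 4 * r"
        using c(2) d(2) ball[OF q] ball[OF q'] by blast+
      then show "mdist ?P q q' \<le> 1 / 2 * r"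
        using mdist_prod_metric_bounds(3)[OF ball(3)[OF q] ball(3)[OF q']] by linarith
    qed
  qed
  then show ?thesis
    by (rule label_cover_imp_doubling)
qed

lemma doubling_finite:
  assumes "finite (mspace X)"
  shows "doubling X"
proof -
  obtain g :: "'a \<Rightarrow> nat" where g: "bij_betw g (mspace X) {0..<card (mspace X)}"
    using ex_bij_betw_finite_nat[OF assms] by blast
  have "label_cover (1 / 2) (card (mspace X)) X"
    unfolding label_cover_def
  proof (intro ballI allI impI exI[of _ g] conjI)
    fix x and r :: real and y assume "r > 0" and y: "y \<in> mcball_of X x r"
    then show "g y < card (mspace X)"
      using bij_betwE[OF g] by simp
    fix z assume z: "z \<in> mcball_of X x r" "g y = g z"
    then have "y = z"
      using g y by (auto simp: bij_betw_def dest: inj_onD)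
    moreover have "mdist X z z = 0"
      using z(1) by simp
    ultimately show "mdist X y z \<le> 1 / 2 * r"
      using \<open>r > 0\<close> by simp
  qed
  then show ?thesis
    by (rule label_cover_imp_doubling)
qed

lemma doubling_interval: "doubling (submetric euclidean_metric {0..h :: real})"
proof -
  have "label_cover (1 / 2) 5 (submetric euclidean_metric {0..h :: real})"
    unfolding label_cover_def
  proof (intro ballI allI impI)
    fix x r :: real assume "x \<in> mspace (submetric euclidean_metric {0..h})" and r: "r > 0"
    let ?B = "mcball_of (submetric euclidean_metric {0..h}) x r"
    \<comment> \<open>The label is the number of the cell of length \<open>r / 2\<close>, counted
      from \<open>x - r\<close>. The value 4 occurs only at the right end point, which is why there
      are five labels.\<close>
    let ?c = "\<lambda>y. nat \<lfloor>2 * (y - x + r) / r\<rfloor>"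
    have B: "0 \<le> 2 * (y - x + r) / r" "2 * (y - x + r) / r \<le> 4" if "y \<in> ?B" for y
      using that r by (auto simp: dist_real_def field_simps abs_le_iff)
    have "?c y < 5" if "y \<in> ?B" for y
      using B[OF that] by linarith
    moreover have "mdist (submetric euclidean_metric {0..h}) y z \<le> 1 / 2 * r"
      if "y \<in> ?B" "z \<in> ?B" "?c y = ?c z" for y z
    proof -
      have "\<bar>2 * (y - x + r) / r - 2 * (z - x + r) / r\<bar> \<le> 1"
        using that(3) B[OF that(1)] B[OF that(2)] by linarith
      moreover have "2 * (y - x + r) / r - 2 * (z - x + r) / r = 2 * (y - z) / r"
        using r by (simp add: field_simps)
      ultimately have "\<bar>2 * (y - z) / r\<bar> \<le> 1"
        by simp
      then have "\<bar>2 * (y - z)\<bar> \<le> r"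
        using r by (simp add: abs_divide divide_le_eq)
      then show ?thesis
        using abs_mult[of 2 "y - z"] by (simp add: dist_real_def)
    qed
    ultimately show "\<exists>c :: real \<Rightarrow> nat. (\<forall>y\<in>?B. c y < 5) \<and> (\<forall>y\<in>?B. \<forall>z\<in>?B. c y = c z \<longrightarrow>
        mdist (submetric euclidean_metric {0..h}) y z \<le> 1 / 2 * r)"
      by (intro exI[of _ ?c] conjI ballI impI)
  qed
  then show ?thesis
    by (rule label_cover_imp_doubling)
qed

section \<open>Uniform disconnectedness for subspaces, products, finite spaces and intervals\<close>

lemma chain_disconnectedD:
  assumes "chain_disconnected \<delta> X" "0 \<le> t" "\<And>i. i \<le> n \<Longrightarrow> z i \<in> mspace X"
    "\<And>i. i < n \<Longrightarrow> mdist X (z i) (z (Suc i)) \<le> t"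
  shows "\<delta> * mdist X (z 0) (z n) \<le> t"
  using assms(1)[unfolded chain_disconnected_def, rule_format, of t n z] assms(2-4) by blast

lemma uniformly_disconnected_embedding:
  assumes f: "isometric_embedding X Y f" and "uniformly_disconnected Y"
  shows "uniformly_disconnected X"
proof -
  obtain \<delta> where \<delta>: "\<delta> > 0" "chain_disconnected \<delta> Y"
    using assms(2) unfolding uniformly_disconnected_iff_chain by blast
  have fY: "f z \<in> mspace Y" if "z \<in> mspace X" for z
    using f that by (auto simp: isometric_embedding_def)
  have dist: "mdist Y (f y) (f z) = mdist X y z" if "y \<in> mspace X" "z \<in> mspace X" for y z
    using f that by (simp add: isometric_embedding_def)
  have "chain_disconnected \<delta> X"
    unfolding chain_disconnected_def
  proof (intro allI impI)
    fix n and z :: "nat \<Rightarrow> 'a" and t :: real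
    assume z: "0 \<le> t \<and> (\<forall>i\<le>n. z i \<in> mspace X) \<and> (\<forall>i<n. mdist X (z i) (z (Suc i)) \<le> t)"
    have "\<delta> * mdist Y (f (z 0)) (f (z n)) \<le> t"
      using z fY dist by (intro chain_disconnectedD[OF \<delta>(2), of t n "\<lambda>i. f (z i)"]) simp_all
    then show "\<delta> * mdist X (z 0) (z n) \<le> t"
      using z dist by simp
  qed
  then show ?thesis
    using \<delta>(1) unfolding uniformly_disconnected_iff_chain by blast
qed

text \<open>Both projections of a chain have steps no longer than the chain itself. The smaller
  constant serves both factors; adding the two end distances costs the factor 1/2.\<close>

lemma uniformly_disconnected_prod:
  assumes "uniformly_disconnected X" "uniformly_disconnected Y"
  shows "uniformly_disconnected (prod_metric X Y)"
proof -
  obtain \<delta>1 where \<delta>1: "\<delta>1 > 0" "chain_disconnected \<delta>1 X"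
    using assms(1) unfolding uniformly_disconnected_iff_chain by blast
  obtain \<delta>2 where \<delta>2: "\<delta>2 > 0" "chain_disconnected \<delta>2 Y"
    using assms(2) unfolding uniformly_disconnected_iff_chain by blast
  define \<delta> where "\<delta> = min \<delta>1 \<delta>2"
  have \<delta>: "\<delta> > 0" "chain_disconnected \<delta> X" "chain_disconnected \<delta> Y"
    using \<delta>1 \<delta>2 chain_disconnected_mono[OF \<delta>1(2)] chain_disconnected_mono[OF \<delta>2(2)] by (simp_all add: \<delta>_def)
  let ?P = "prod_metric X Y"
  have "chain_disconnected (\<delta> / 2) ?P"
    unfolding chain_disconnected_def
  proof (intro allI impI)
    fix n and z :: "nat \<Rightarrow> 'a \<times> 'b" and t :: real
    assume z: "0 \<le> t \<and> (\<forall>i\<le>n. z i \<in> mspace ?P) \<and> (\<forall>i<n. mdist ?P (z i) (z (Suc i)) \<le> t)"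
    then have t: "0 \<le> t" and zP: "\<And>i. i \<le> n \<Longrightarrow> z i \<in> mspace ?P"
      and step: "\<And>i. i < n \<Longrightarrow> mdist ?P (z i) (z (Suc i)) \<le> t"
      by blast+
    have "fst (z i) \<in> mspace X" "snd (z i) \<in> mspace Y" if "i \<le> n" for i
      using zP[OF that] by auto
    moreover have "mdist X (fst (z i)) (fst (z (Suc i))) \<le> t" "mdist Y (snd (z i)) (snd (z (Suc i))) \<le> t" if "i < n" for i
      using mdist_prod_metric_bounds(1,2)[OF zP[of i] zP[of "Suc i"]] step[OF that] that
      by (meson Suc_leI less_imp_le order_trans)+
    ultimately have "\<delta> * mdist X (fst (z 0)) (fst (z n)) \<le> t" "\<delta> * mdist Y (snd (z 0)) (snd (z n)) \<le> t"
      using chain_disconnectedD[OF \<delta>(2) t, of n "\<lambda>i. fst (z i)"] chain_disconnectedD[OF \<delta>(3) t, of n "\<lambda>i. snd (z i)"]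
      by blast+
    moreover have "\<delta> / 2 * mdist ?P (z 0) (z n) \<le> \<delta> / 2 * (mdist X (fst (z 0)) (fst (z n)) + mdist Y (snd (z 0)) (snd (z n)))"
      using \<delta>(1) mdist_prod_metric_bounds(3)[OF zP[of 0] zP[of n]] by (intro mult_left_mono) auto
    ultimately show "\<delta> / 2 * mdist ?P (z 0) (z n) \<le> t"
      by (simp add: algebra_simps)
  qed
  then show ?thesis
    using \<delta>(1) half_gt_zero unfolding uniformly_disconnected_iff_chain by blast
qed

lemma uniformly_disconnected_finite:
  assumes fin: "finite (mspace X)"
  shows "uniformly_disconnected X"
proof -
  \<comment> \<open>The constant is the least gap divided by the largest distance. Chains with steps
    below every gap are constant; for all others the largest distance gives the bound. The inserted
    1 covers one-point spaces and keeps \<open>Max D\<close> positive.\<close>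
  define S where "S = insert 1 ((\<lambda>(x, y). mdist X x y) ` {(x, y) \<in> mspace X \<times> mspace X. x \<noteq> y})"
  define D where "D = insert 1 ((\<lambda>(x, y). mdist X x y) ` (mspace X \<times> mspace X))"
  have "finite {(x, y) \<in> mspace X \<times> mspace X. x \<noteq> y}"
    by (rule finite_subset[OF _ finite_cartesian_product[OF fin fin]]) auto
  then have S: "finite S" "\<And>s. s \<in> S \<Longrightarrow> 0 < s"
    by (auto simp: S_def less_le)
  have D: "finite D" "1 \<le> Max D"
    using fin by (auto simp: D_def)
  have "0 < Min S"
    using S by (simp add: S_def)
  have "chain_disconnected (Min S / Max D) X"
    unfolding chain_disconnected_def
  proof (intro allI impI)
    fix n and z :: "nat \<Rightarrow> 'a" and t :: real
    assume z: "0 \<le> t \<and> (\<forall>i\<le>n. z i \<in> mspace X) \<and> (\<forall>i<n. mdist X (z i) (z (Suc i)) \<le> t)"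
    show "Min S / Max D * mdist X (z 0) (z n) \<le> t"
    proof (cases "t < Min S")
      case True
      have "z i = z 0" if "i \<le> n" for i
        using that
      proof (induction i)
        case (Suc i)
        have "z i = z (Suc i)"
        proof (rule ccontr)
          assume "z i \<noteq> z (Suc i)"
          then have "mdist X (z i) (z (Suc i)) \<in> S"
            using z Suc.prems by (auto simp: S_def intro!: image_eqI[where x = "(z i, z (Suc i))"])
          then have "Min S \<le> mdist X (z i) (z (Suc i))"
            using S(1) by simp
          moreover have "mdist X (z i) (z (Suc i)) \<le> t"
            using z Suc.prems by simp
          ultimately show False
            using True by simp
        qed
        then show ?case
          using Suc by simp
      qed simp
      then have "z n = z 0"
        by blast
      moreover have "mdist X (z 0) (z 0) = 0"
        using z by simp
      ultimately show ?thesis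
        using z by simp
    next
      case False
      have "mdist X (z 0) (z n) \<in> D"
        using z by (auto simp: D_def intro!: image_eqI[where x = "(z 0, z n)"])
      then have "mdist X (z 0) (z n) \<le> Max D"
        using D(1) by simp
      then have "Min S / Max D * mdist X (z 0) (z n) \<le> Min S / Max D * Max D"
        using \<open>0 < Min S\<close> D(2) by (intro mult_left_mono) auto
      also have "\<dots> \<le> t"
        using False D(2) by simp
      finally show ?thesis .
    qed
  qed
  moreover have "0 < Min S / Max D"
    using \<open>0 < Min S\<close> D(2) by simp
  ultimately show ?thesis
    unfolding uniformly_disconnected_iff_chain by blast
qed

text \<open>Dividing the interval into \<open>Suc n\<close> equal steps would force
  \<open>\<delta>\<close> to be at most \<open>1 / real (Suc n)\<close>.\<close>

lemma not_uniformly_disconnected_interval: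
  assumes "h > 0"
  shows "\<not> uniformly_disconnected (submetric euclidean_metric {0..h :: real})"
proof
  assume "uniformly_disconnected (submetric euclidean_metric {0..h})"
  then obtain \<delta> where \<delta>: "\<delta> > 0" "chain_disconnected \<delta> (submetric euclidean_metric {0..h})"
    unfolding uniformly_disconnected_iff_chain by blast
  obtain n where n: "1 / real (Suc n) < \<delta>"
    using nat_approx_posE[OF \<delta>(1)] .
  have "\<delta> * mdist (submetric euclidean_metric {0..h}) (h * real 0 / real (Suc n)) (h * real (Suc n) / real (Suc n)) \<le> h / real (Suc n)"
  proof (rule chain_disconnectedD[OF \<delta>(2)])
    show "h * real i / real (Suc n) \<in> mspace (submetric euclidean_metric {0..h})" if "i \<le> Suc n" for i
    proof -
      have "h * real i \<le> h * real (Suc n)"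
        using assms that by (intro mult_left_mono) auto
      then show ?thesis
        using assms by (simp add: divide_le_eq)
    qed
    show "mdist (submetric euclidean_metric {0..h}) (h * real i / real (Suc n)) (h * real (Suc i) / real (Suc n)) \<le> h / real (Suc n)" for i
    proof -
      have "h * real (Suc i) / real (Suc n) = h * real i / real (Suc n) + h / real (Suc n)"
        by (simp only: of_nat_Suc[of i] distrib_left add_divide_distrib mult_1_right add.commute)
      then show ?thesis
        using assms by (simp add: dist_real_def)
    qed
  qed (use assms in auto)
  then have "\<delta> * h \<le> h * (1 / real (Suc n))"
    using assms by (simp add: dist_real_def)
  also have "\<dots> < h * \<delta>"
    using n assms by (intro mult_strict_left_mono)
  finally show False
    by simp
qed

section \<open>Criteria for and against uniform perfectness\<close>

lemma uniformly_perfectI_small_radii: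
  assumes X: "nonempty_compact_metric X" and c: "0 < c" "c \<le> 1" and "0 < \<rho>"
    and small: "\<And>x r. \<lbrakk>x \<in> mspace X; 0 < r; r \<le> \<rho>\<rbrakk> \<Longrightarrow> \<exists>y\<in>mspace X. c * r \<le> mdist X x y \<and> mdist X x y \<le> r"
  shows "uniformly_perfect X"
proof -
  obtain D where D: "D > 0" "\<forall>x\<in>mspace X. \<forall>y\<in>mspace X. mdist X x y \<le> D"
    using mdist_bounded[OF X] by blast
  \<comment> \<open>Scales every radius below the diameter down to at most \<open>\<rho>\<close>.
    The summand \<open>\<rho>\<close> in the denominator makes \<open>q < 1\<close>, so that
    \<open>c * q\<close> is an admissible constant.\<close>
  define q where "q = \<rho> / (\<rho> + D)"
  have q: "0 < q" "q < 1"
    using D(1) \<open>0 < \<rho>\<close> by (auto simp: q_def)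
  have qD: "q * D \<le> \<rho>"
    using D(1) \<open>0 < \<rho>\<close> by (simp add: q_def field_simps)
  have "c * q < 1"
    using mult_right_mono[OF c(2), of q] q by linarith
  moreover have "uniformly_perfect_with (c * q) X"
    unfolding uniformly_perfect_with_def
  proof (intro ballI)
    fix x r assume x: "x \<in> mspace X" and r: "r \<in> {0<..<metric_diameter X}"
    then obtain a b where "a \<in> mspace X" "b \<in> mspace X" "r < mdist X a b"
      using less_metric_diameter_iff[OF X] by auto
    then have "r < D"
      using D(2) by fastforce
    have "0 < min r \<rho>"
      using r \<open>0 < \<rho>\<close> by simp
    \<comment> \<open>Large radii are truncated at \<open>\<rho>\<close>; the annulus point found
      there also serves for \<open>r\<close>, with the smaller constant.\<close>
    then obtain y where y: "y \<in> mspace X" "c * min r \<rho> \<le> mdist X x y" "mdist X x y \<le> min r \<rho>"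
      using small[OF x, of "min r \<rho>"] by auto
    have "q * r \<le> min r \<rho>"
    proof (rule min.boundedI)
      show "q * r \<le> r"
        using q r by simp
      have "q * r \<le> q * D"
        using q(1) \<open>r < D\<close> by simp
      then show "q * r \<le> \<rho>"
        using qD by simp
    qed
    then have "c * q * r \<le> c * min r \<rho>"
      using c(1) by (simp add: mult.assoc)
    then show "\<exists>y\<in>mspace X. c * q * r \<le> mdist X x y \<and> mdist X x y \<le> r"
      using y by (intro bexI[of _ y]) auto
  qed
  ultimately show ?thesis
    using c(1) q(1) unfolding uniformly_perfect_def by (intro bexI[of _ "c * q"]) auto
qed

text \<open>Because of \<open>q\<close> the radius \<open>h / 2\<close> is below the diameter, yet
  the ball of that radius around \<open>p\<close> contains \<open>p\<close> alone.\<close>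

lemma not_uniformly_perfect_isolated:
  assumes X: "nonempty_compact_metric X" and p: "p \<in> mspace X" and q: "q \<in> mspace X" "q \<noteq> p"
    and "0 < h" and iso: "\<And>y. \<lbrakk>y \<in> mspace X; y \<noteq> p\<rbrakk> \<Longrightarrow> h \<le> mdist X p y"
  shows "\<not> uniformly_perfect X"
proof
  assume "uniformly_perfect X"
  then obtain c where c: "0 < c" "uniformly_perfect_with c X"
    by (auto simp: uniformly_perfect_def)
  have "h / 2 < mdist X p q"
    using iso[OF q] \<open>0 < h\<close> by simp
  then have "h / 2 \<in> {0<..<metric_diameter X}"
    using less_metric_diameter_iff[OF X] p q(1) \<open>0 < h\<close> by auto
  then obtain y where y: "y \<in> mspace X" "c * (h / 2) \<le> mdist X p y" "mdist X p y \<le> h / 2"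
    using c(2) p unfolding uniformly_perfect_with_def by blast
  have "y = p"
    using iso[OF y(1)] y(3) \<open>0 < h\<close> by fastforce
  moreover have "mdist X p p = 0"
    using p by simp
  moreover have "0 < c * (h / 2)"
    using c(1) \<open>0 < h\<close> by simp
  ultimately show False
    using y(2) by simp
qed

section \<open>Cantor spaces with prescribed scales\<close>

text \<open>
  The binary sequences with this ultrametric are always uniformly disconnected; the decay of \<open>a\<close>
  decides whether they are doubling.
\<close>

definition cantor_dist :: "(nat \<Rightarrow> real) \<Rightarrow> (nat \<Rightarrow> bool) \<Rightarrow> (nat \<Rightarrow> bool) \<Rightarrow> real" where
  "cantor_dist a x y = (if x = y then 0 else a (LEAST n. x n \<noteq> y n))"

definition cantor_metric :: "(nat \<Rightarrow> real) \<Rightarrow> (nat \<Rightarrow> bool) metric" where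
  "cantor_metric a = metric (UNIV, cantor_dist a)"

text \<open>Strict decrease lets a distance determine the index of the first difference, whence the
  ultrametric inequality. Convergence to 0 puts a cylinder into every ball, whence
  compactness.\<close>

locale cantor_scale =
  fixes a :: "nat \<Rightarrow> real"
  assumes pos: "0 < a n" and decreasing: "a (Suc n) < a n" and tendsto_0: "a \<longlonglongrightarrow> 0"
begin

lemma less_iff: "a m < a n \<longleftrightarrow> n < m"
proof -
  have *: "a m < a n" if "n < m" for m n
    using that decreasing by (rule lift_Suc_mono_less[where f = "\<lambda>n. - a n", simplified, rotated])
  show ?thesis
    using *[of m n] *[of n m] by (cases m n rule: linorder_cases) auto
qed

lemma le_iff: "a m \<le> a n \<longleftrightarrow> n \<le> m"
  using less_iff[of n m] by (simp add: not_less[symmetric])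

lemma ex_less: "0 < e \<Longrightarrow> \<exists>n. a n < e"
  using order_tendstoD(2)[OF tendsto_0] eventually_happens'[OF sequentially_bot] by blast

lemma dist_eq:
  assumes "x n \<noteq> y n" "\<And>i. i < n \<Longrightarrow> x i = y i"
  shows "cantor_dist a x y = a n"
proof -
  have "(LEAST n. x n \<noteq> y n) = n"
    using assms by (intro Least_equality) (auto simp: not_less[symmetric])
  then show ?thesis
    using assms(1) by (auto simp: cantor_dist_def)
qed

lemma first_difference:
  assumes "x \<noteq> y"
  shows "\<exists>n. x n \<noteq> y n \<and> (\<forall>i<n. x i = y i) \<and> cantor_dist a x y = a n"
proof -
  have "\<exists>n. x n \<noteq> y n"
    using assms by auto
  then have *: "x (LEAST n. x n \<noteq> y n) \<noteq> y (LEAST n. x n \<noteq> y n)"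
    by (rule LeastI_ex)
  have **: "\<forall>i<LEAST n. x n \<noteq> y n. x i = y i"
    using not_less_Least by blast
  show ?thesis
    using * ** dist_eq[of x "LEAST n. x n \<noteq> y n" y] by blast
qed

text \<open>Closed balls at the scales are cylinders; this links the metric to the product topology
  and to labelling by a coordinate.\<close>

lemma dist_le_iff: "cantor_dist a x y \<le> a n \<longleftrightarrow> (\<forall>i<n. x i = y i)"
proof (cases "x = y")
  case True
  then show ?thesis
    using pos[of n] by (simp add: cantor_dist_def)
next
  case False
  obtain m where m: "x m \<noteq> y m" "\<And>i. i < m \<Longrightarrow> x i = y i" "cantor_dist a x y = a m"
    using first_difference[OF False] by blast
  then show ?thesis
    by (metis le_iff not_less order_less_le_trans)
qed

lemma dist_nonneg: "0 \<le> cantor_dist a x y"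
  using pos by (simp add: cantor_dist_def less_imp_le)

lemma dist_eq_0_iff: "cantor_dist a x y = 0 \<longleftrightarrow> x = y"
  using pos by (simp add: cantor_dist_def less_imp_neq[symmetric])

lemma dist_commute: "cantor_dist a x y = cantor_dist a y x"
proof -
  have "(\<lambda>n. x n \<noteq> y n) = (\<lambda>n. y n \<noteq> x n)"
    by auto
  then show ?thesis
    by (simp add: cantor_dist_def)
qed

lemma dist_le_a0: "cantor_dist a x y \<le> a 0"
  by (simp add: dist_le_iff)

text \<open>Let \<open>m\<close> be the first place where \<open>x\<close> and \<open>z\<close>
  differ. Distances below \<open>a m\<close> would make both agree with \<open>y\<close> at
  \<open>m\<close>.\<close>

lemma ultrametric: "cantor_dist a x z \<le> max (cantor_dist a x y) (cantor_dist a y z)"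
proof (cases "x = z")
  case True
  then have "cantor_dist a x z = 0"
    by (simp add: dist_eq_0_iff)
  then show ?thesis
    using dist_nonneg by (simp add: le_max_iff_disj)
next
  case False
  obtain m where m: "x m \<noteq> z m" "\<And>i. i < m \<Longrightarrow> x i = z i" "cantor_dist a x z = a m"
    using first_difference[OF False] by blast
  show ?thesis
  proof (rule ccontr)
    assume "\<not> ?thesis"
    then have less: "cantor_dist a x y < a m" "cantor_dist a y z < a m"
      using m(3) by auto
    have "u m = v m" if "cantor_dist a u v < a m" for u v
    proof (cases "u = v")
      case False
      obtain k where k: "u k \<noteq> v k" "\<And>i. i < k \<Longrightarrow> u i = v i" "cantor_dist a u v = a k"
        using first_difference[OF False] by blast
      then show ?thesis
        using that less_iff by simp
    qed simp
    then show False
      using less m(1) by metis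
  qed
qed

sublocale Metric_space UNIV "cantor_dist a"
proof
  fix x y z
  show "cantor_dist a x z \<le> cantor_dist a x y + cantor_dist a y z"
    using ultrametric[of x z y] dist_nonneg[of x y] dist_nonneg[of y z] by linarith
qed (simp_all add: dist_nonneg dist_eq_0_iff dist_commute)

lemma mspace_cantor [simp]: "mspace (cantor_metric a) = UNIV"
  by (simp add: cantor_metric_def)

lemma mdist_cantor [simp]: "mdist (cantor_metric a) = cantor_dist a"
  by (simp add: cantor_metric_def)

text \<open>Makes the identity from the product topology continuous, which carries compactness from
  a product of finite spaces over to the metric topology.\<close>

lemma openin_imp_open:
  assumes "openin mtopology U"
  shows "open U"
proof (subst open_subopen, intro ballI)
  fix x assume x: "x \<in> U"
  obtain r where r: "r > 0" "mball x r \<subseteq> U"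
    using assms x unfolding openin_mtopology by blast
  obtain n where n: "a n < r"
    using ex_less[OF r(1)] by blast
  define V where "V = (\<Inter>i<n. (\<lambda>y. y i) -` {x i})"
  have "open V"
    unfolding V_def
    by (intro open_INT ballI open_vimage open_discrete continuous_on_product_coordinates) auto
  moreover have "x \<in> V"
    by (simp add: V_def)
  moreover have "V \<subseteq> U"
  proof
    fix y assume "y \<in> V"
    then have "cantor_dist a x y \<le> a n"
      by (simp add: V_def dist_le_iff)
    then have "y \<in> mball x r"
      using n by simp
    then show "y \<in> U"
      using r(2) by blast
  qed
  ultimately show "\<exists>T. open T \<and> x \<in> T \<and> T \<subseteq> U"
    by blast
qed

lemma nonempty_compact_metric_cantor: "nonempty_compact_metric (cantor_metric a)"
proof -
  have "compact_space (euclidean :: bool topology)"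
    by (simp add: compact_space_def finite_imp_compact)
  then have "compact_space (product_topology (\<lambda>_ :: nat. euclidean :: bool topology) UNIV)"
    by (simp add: compact_space_product_topology)
  then have compact: "compactin (euclidean :: (nat \<Rightarrow> bool) topology) UNIV"
    by (simp only: euclidean_product_topology compact_space_def topspace_euclidean)
  have "continuous_map euclidean mtopology (\<lambda>x. x)"
    unfolding continuous_map_def using openin_imp_open by (auto simp: open_openin[symmetric])
  from image_compactin[OF compact this] show ?thesis
    by (simp add: nonempty_compact_metric_def compact_space_def cantor_metric_def)
qed

text \<open>In an ultrametric a chain never gets farther from its start than its longest step, so
  the constant 1 works.\<close>

lemma uniformly_disconnected_cantor: "uniformly_disconnected (cantor_metric a)"
proof -
  have "chain_disconnected 1 (cantor_metric a)"
    unfolding chain_disconnected_def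
  proof (intro allI impI)
    fix n z and t :: real
    assume z: "0 \<le> t \<and> (\<forall>i\<le>n. z i \<in> mspace (cantor_metric a)) \<and>
      (\<forall>i<n. mdist (cantor_metric a) (z i) (z (Suc i)) \<le> t)"
    have "cantor_dist a (z 0) (z i) \<le> t" if "i \<le> n" for i
      using that
    proof (induction i)
      case 0
      then show ?case
        using z by (simp add: cantor_dist_def)
    next
      case (Suc i)
      then have "cantor_dist a (z 0) (z i) \<le> t" "cantor_dist a (z i) (z (Suc i)) \<le> t"
        using z by auto
      then show ?case
        using ultrametric[of "z 0" "z (Suc i)" "z i"] by linarith
    qed
    then show "1 * mdist (cantor_metric a) (z 0) (z n) \<le> t"
      by simp
  qed
  then show ?thesis
    using zero_less_one unfolding uniformly_disconnected_iff_chain by blast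
qed

text \<open>Flipping coordinate \<open>n\<close> moves a point by exactly \<open>a n\<close>. For
  the first scale not above \<open>r\<close>, the preceding one exceeds \<open>r\<close>, hence
  \<open>a n\<close> is at least \<open>r / 2\<close>; at index 0 this follows from
  \<open>r \<le> a 0\<close>.\<close>

lemma cantor_annulus:
  assumes half: "\<And>n. a n \<le> 2 * a (Suc n)" and r: "0 < r" "r \<le> a 0"
  shows "\<exists>y. r / 2 \<le> cantor_dist a x y \<and> cantor_dist a x y \<le> r"
proof -
  define n where "n = (LEAST n. a n \<le> r)"
  have "\<exists>n. a n \<le> r"
    using ex_less[OF r(1)] less_imp_le by blast
  then have n: "a n \<le> r"
    unfolding n_def by (rule LeastI_ex)
  have "r \<le> 2 * a n"
  proof (cases n)
    case 0
    then show ?thesis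
      using r pos[of 0] by simp
  next
    case (Suc m)
    then have "\<not> a m \<le> r"
      using not_less_Least[of m "\<lambda>n. a n \<le> r"] by (simp add: n_def)
    then show ?thesis
      using half[of m] Suc by simp
  qed
  moreover have "cantor_dist a x (x(n := \<not> x n)) = a n"
    by (rule dist_eq) auto
  ultimately show ?thesis
    using n by (intro exI[of _ "x(n := \<not> x n)"]) simp
qed

text \<open>A ball lies in the cylinder that fixes the coordinates before the first scale not above
  \<open>r\<close>. The next coordinate splits it into two parts, whose diameter is at most half
  that scale.\<close>

lemma doubling_cantor:
  assumes half: "\<And>n. 2 * a (Suc n) \<le> a n"
  shows "doubling (cantor_metric a)"
proof -
  have "label_cover (1 / 2) 2 (cantor_metric a)"
    unfolding label_cover_def
  proof (intro ballI allI impI)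
    fix x and r :: real assume "r > 0"
    define n where "n = (LEAST n. a n \<le> r)"
    have "\<exists>n. a n \<le> r"
      using ex_less[OF \<open>r > 0\<close>] less_imp_le by blast
    then have n: "a n \<le> r"
      unfolding n_def by (rule LeastI_ex)
    let ?B = "mcball_of (cantor_metric a) x r"
    \<comment> \<open>Points of the ball are closer to \<open>x\<close> than the scale preceding
      \<open>n\<close>, which forces agreement before \<open>n\<close>; for \<open>n = 0\<close>
      nothing is claimed.\<close>
    have agree: "x i = y i" if y: "y \<in> ?B" and "i < n" for y i
    proof -
      obtain m where m: "n = Suc m"
        using \<open>i < n\<close> by (cases n) auto
      have "\<not> a m \<le> r"
        using not_less_Least[of m "\<lambda>n. a n \<le> r"] m by (simp add: n_def)
      then have "cantor_dist a x y < a m"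
        using y by simp
      show ?thesis
      proof (cases "x = y")
        case False
        obtain k where "x k \<noteq> y k" "\<And>i. i < k \<Longrightarrow> x i = y i" "cantor_dist a x y = a k"
          using first_difference[OF False] by blast
        then show ?thesis
          using \<open>cantor_dist a x y < a m\<close> \<open>i < n\<close> m less_iff by simp
      qed simp
    qed
    let ?c = "\<lambda>y :: nat \<Rightarrow> bool. if y n then 1 else 0 :: nat"
    have "mdist (cantor_metric a) y z \<le> 1 / 2 * r" if yz: "y \<in> ?B" "z \<in> ?B" "?c y = ?c z" for y z
    proof -
      have "y i = z i" if "i < Suc n" for i
        using agree[OF yz(1)] agree[OF yz(2)] yz(3) that by (cases "i = n") (auto split: if_splits)
      then have "cantor_dist a y z \<le> a (Suc n)"
        by (simp add: dist_le_iff)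
      then show ?thesis
        using half[of n] n by simp
    qed
    then show "\<exists>c :: (nat \<Rightarrow> bool) \<Rightarrow> nat. (\<forall>y\<in>?B. c y < 2) \<and> (\<forall>y\<in>?B. \<forall>z\<in>?B. c y = c z \<longrightarrow>
        mdist (cantor_metric a) y z \<le> 1 / 2 * r)"
      by (intro exI[of _ ?c] conjI ballI impI) simp_all
  qed
  then show ?thesis
    by (rule label_cover_imp_doubling)
qed

text \<open>The indicator sequences of the \<open>N + 1\<close> places from \<open>N\<close> to
  \<open>2 * N\<close> lie within \<open>a N\<close> of the zero sequence and at least
  \<open>a (2 * N)\<close> from each other, one point too many for a packing.\<close>

lemma not_doubling_cantor:
  assumes slow: "\<And>n. a n < 2 * a (2 * n)"
  shows "\<not> doubling (cantor_metric a)"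
proof
  assume "doubling (cantor_metric a)"
  then obtain N where N: "packing N (cantor_metric a)"
    unfolding doubling_iff_packing by blast
  define e where "e k = (\<lambda>i :: nat. i = k)" for k
  have e_eq: "e k = e l \<longleftrightarrow> k = l" for k l
    by (auto simp: e_def fun_eq_iff)
  have e_dist: "cantor_dist a (e k) (e l) = a (min k l)" if "k \<noteq> l" for k l
  proof (cases "k < l")
    case True
    then show ?thesis
      using dist_eq[of "e k" k "e l"] by (simp add: e_def)
  next
    case False
    then show ?thesis
      using dist_eq[of "e k" l "e l"] that by (simp add: e_def)
  qed
  have "e ` {N..2 * N} \<subseteq> mcball_of (cantor_metric a) (\<lambda>_. False) (a N)"
    by (auto simp: dist_le_iff e_def)
  moreover have "a N / 2 < mdist (cantor_metric a) y z"
    if "y \<in> e ` {N..2 * N}" "z \<in> e ` {N..2 * N}" "y \<noteq> z" for y z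
  proof -
    from that have "\<exists>k l. y = e k \<and> z = e l \<and> k \<le> 2 * N \<and> l \<le> 2 * N \<and> k \<noteq> l"
      by (auto simp: e_eq)
    then obtain k l where "y = e k" "z = e l" "k \<le> 2 * N" "l \<le> 2 * N" "k \<noteq> l"
      by blast
    then have "a (2 * N) \<le> cantor_dist a y z"
      by (simp add: e_dist le_iff min_le_iff_disj)
    then show ?thesis
      using slow[of N] by simp
  qed
  ultimately have "card (e ` {N..2 * N}) \<le> N"
    using N[unfolded packing_def, rule_format, of "\<lambda>_. False" "a N" "e ` {N..2 * N}"] pos by simp
  moreover have "inj_on e {N..2 * N}"
    by (auto simp: inj_on_def e_eq)
  ultimately show False
    by (simp add: card_image)
qed

end

text \<open>Geometric scales satisfy \<open>a n = 2 * a (Suc n)\<close>, which suits both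
  \<open>doubling_cantor\<close> and \<open>cantor_annulus\<close>. Harmonic ones satisfy
  \<open>a n < 2 * a (2 * n)\<close>, which defeats doubling, while
  \<open>a n \<le> 2 * a (Suc n)\<close> still provides annuli.\<close>

lemma ex_cantor_metric:
  fixes h :: real
  assumes "h > 0"
  shows "\<exists>K :: (nat \<Rightarrow> bool) metric. nonempty_compact_metric K \<and> doubling K = b \<and>
    uniformly_disconnected K \<and> (\<forall>x\<in>mspace K. \<forall>y\<in>mspace K. mdist K x y \<le> h) \<and>
    (\<forall>x\<in>mspace K. \<forall>r. 0 < r \<longrightarrow> r \<le> h \<longrightarrow> (\<exists>y\<in>mspace K. r / 2 \<le> mdist K x y \<and> mdist K x y \<le> r))"
proof -
  define a where "a n = (if b then h / 2 ^ n else h / real (Suc n))" for n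
  interpret cantor_scale a
  proof
    show "0 < a n" for n
      using assms by (simp add: a_def)
    show "a (Suc n) < a n" for n
      using assms by (auto simp: a_def field_simps)
    show "a \<longlonglongrightarrow> 0"
    proof (cases b)
      case True
      then have "a = (\<lambda>n. h * (1 / 2) ^ n)"
        by (simp add: a_def fun_eq_iff power_one_over)
      also have "\<dots> \<longlonglongrightarrow> 0"
        by (intro tendsto_mult_right_zero LIMSEQ_power_zero) simp
      finally show ?thesis .
    next
      case False
      then have "a = (\<lambda>n. h * inverse (real (Suc n)))"
        by (simp add: a_def fun_eq_iff divide_inverse)
      also have "\<dots> \<longlonglongrightarrow> 0"
        by (intro tendsto_mult_right_zero LIMSEQ_inverse_real_of_nat)
      finally show ?thesis .
    qed
  qed
  have a0: "a 0 = h"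
    by (simp add: a_def)
  have "doubling (cantor_metric a) = b"
  proof (cases b)
    case True
    then have "doubling (cantor_metric a)"
      by (intro doubling_cantor) (simp add: a_def)
    then show ?thesis
      using True by simp
  next
    case False
    then have "\<not> doubling (cantor_metric a)"
      using assms by (intro not_doubling_cantor) (simp add: a_def field_simps)
    then show ?thesis
      using False by simp
  qed
  moreover have "a n \<le> 2 * a (Suc n)" for n
    using assms by (auto simp: a_def field_simps)
  then have "\<exists>y. r / 2 \<le> cantor_dist a x y \<and> cantor_dist a x y \<le> r" if "0 < r" "r \<le> h" for x r
    using cantor_annulus[of r x] that a0 by simp
  ultimately show ?thesis
    using nonempty_compact_metric_cantor uniformly_disconnected_cantor dist_le_a0 a0
    by (intro exI[of _ "cantor_metric a"]) simp
qed

section \<open>Density\<close>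

lemma ex_finite_net:
  assumes "nonempty_compact_metric X" "e > 0"
  shows "\<exists>A. finite A \<and> A \<noteq> {} \<and> A \<subseteq> mspace X \<and> (\<forall>x\<in>mspace X. \<exists>a\<in>A. mdist X a x \<le> e)"
proof -
  interpret M: Metric_space "mspace X" "mdist X"
    by simp
  have "M.mtotally_bounded (mspace X)"
    using assms(1) by (simp add: nonempty_compact_metric_def mtopology_of_def
        M.compact_space_eq_mcomplete_mtotally_bounded)
  then have "\<exists>A. finite A \<and> A \<subseteq> mspace X \<and> mspace X \<subseteq> (\<Union>a\<in>A. M.mball a e)"
    using assms(2) unfolding M.mtotally_bounded_def by simp
  then obtain A where A: "finite A" "A \<subseteq> mspace X" "mspace X \<subseteq> (\<Union>a\<in>A. M.mball a e)"
    by blast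
  have "\<exists>a\<in>A. mdist X a x \<le> e" if x: "x \<in> mspace X" for x
  proof -
    obtain a where "a \<in> A" "x \<in> M.mball a e"
      using A(3) x by blast
    then show ?thesis
      by (intro bexI[of _ a]) auto
  qed
  moreover from this have "A \<noteq> {}"
    using assms(1) by (auto simp: nonempty_compact_metric_def)
  ultimately show ?thesis
    using A by blast
qed

lemma ex_uniformly_perfect_approximation:
  fixes X :: "'a metric"
  assumes X: "nonempty_compact_metric X" and "e > 0"
  shows "\<exists>Y :: (('a \<times> real) \<times> (nat \<Rightarrow> bool)) metric. nonempty_compact_metric Y \<and> gh_close e X Y \<and>
    doubling Y = b \<and> uniformly_disconnected Y = b' \<and> uniformly_perfect Y"
proof -
  \<comment> \<open>The two net points contribute \<open>2 * h\<close> to the change of a distance,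
    \<open>J\<close> and \<open>K\<close> contribute \<open>h\<close> each: at most
    \<open>4 * h = e\<close> in all.\<close>
  define h where "h = e / 4"
  have "h > 0"
    using \<open>e > 0\<close> by (simp add: h_def)
  obtain A where A: "finite A" "A \<noteq> {}" "A \<subseteq> mspace X" "\<And>x. x \<in> mspace X \<Longrightarrow> \<exists>a\<in>A. mdist X a x \<le> h"
    using ex_finite_net[OF X \<open>h > 0\<close>] by blast
  obtain K :: "(nat \<Rightarrow> bool) metric" where K: "nonempty_compact_metric K" "doubling K = b" "uniformly_disconnected K"
    "\<forall>x\<in>mspace K. \<forall>y\<in>mspace K. mdist K x y \<le> h"
    "\<forall>x\<in>mspace K. \<forall>r. 0 < r \<longrightarrow> r \<le> h \<longrightarrow> (\<exists>y\<in>mspace K. r / 2 \<le> mdist K x y \<and> mdist K x y \<le> r)"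
    using ex_cantor_metric[OF \<open>h > 0\<close>, of b] by blast
  define XA where "XA = submetric X A"
  \<comment> \<open>With \<open>t = 0\<close> the interval degenerates to a point, so a single
    construction serves both values of \<open>b'\<close>.\<close>
  define t where "t = (if b' then 0 else h)"
  have t: "0 \<le> t" "t \<le> h"
    using \<open>h > 0\<close> by (auto simp: t_def)
  define J :: "real metric" where "J = submetric euclidean_metric {0..t}"
  define B where "B = prod_metric XA J"
  define Y where "Y = prod_metric B K"
  have XA: "mspace XA = A" "mdist XA = mdist X" "nonempty_compact_metric XA"
    using A nonempty_compact_metric_submetric[OF finite_imp_compactin, of A X]
    by (auto simp: XA_def)
  have J: "mspace J = {0..t}" "mdist J = dist"
    by (auto simp: J_def)
  have "nonempty_compact_metric J"
    unfolding J_def using t by (intro nonempty_compact_metric_submetric) auto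
  then have compact_B: "nonempty_compact_metric B"
    unfolding B_def using XA by (intro nonempty_compact_metric_prod)
  then have compact_Y: "nonempty_compact_metric Y"
    unfolding Y_def using K by (intro nonempty_compact_metric_prod)
  obtain a0 where a0: "a0 \<in> A"
    using A(2) by blast
  obtain k0 where k0: "k0 \<in> mspace K"
    using K(1) by (auto simp: nonempty_compact_metric_def)
  have "(a0, 0) \<in> mspace B"
    using a0 t by (simp add: B_def XA J)
  \<comment> \<open>\<open>K\<close> and \<open>J\<close> are slices of \<open>Y\<close>; failure of
    doubling or of uniform disconnectedness in a slice passes to \<open>Y\<close>.\<close>
  have emb_K: "isometric_embedding K Y (\<lambda>k. ((a0, 0), k))"
    unfolding Y_def by (rule isometric_embedding_Pair_left[OF \<open>(a0, 0) \<in> mspace B\<close>])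
  have "isometric_embedding J B (\<lambda>j. (a0, j))"
    unfolding B_def using a0 XA by (intro isometric_embedding_Pair_left) simp
  moreover have "isometric_embedding B Y (\<lambda>p. (p, k0))"
    unfolding Y_def by (rule isometric_embedding_Pair_right[OF k0])
  ultimately have emb_J: "isometric_embedding J Y ((\<lambda>p. (p, k0)) \<circ> (\<lambda>j. (a0, j)))"
    by (rule isometric_embedding_comp)
  have finite_XA: "finite (mspace XA)"
    using A XA by simp
  have "doubling Y = b"
  proof
    assume "doubling Y"
    then show b
      using doubling_embedding[OF emb_K] K(2) by simp
  next
    assume b
    then have "doubling K"
      using K(2) by simp
    moreover have "doubling J"
      unfolding J_def by (rule doubling_interval)
    ultimately show "doubling Y"
      unfolding Y_def B_def by (intro doubling_prod doubling_finite[OF finite_XA])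
  qed
  moreover have "uniformly_disconnected Y = b'"
  proof
    assume "uniformly_disconnected Y"
    then have "uniformly_disconnected J"
      by (rule uniformly_disconnected_embedding[OF emb_J])
    then show b'
      using not_uniformly_disconnected_interval[OF \<open>h > 0\<close>] by (auto simp: J_def t_def split: if_splits)
  next
    assume b'
    then have "finite (mspace J)"
      by (simp add: J t_def)
    then show "uniformly_disconnected Y"
      unfolding Y_def B_def
      by (intro uniformly_disconnected_prod uniformly_disconnected_finite finite_XA K(3))
  qed
  moreover have "uniformly_perfect Y"
  \<comment> \<open>Annulus points are found by moving in the \<open>K\<close> coordinate alone,
    which leaves the threshold \<open>h\<close> independent of \<open>A\<close> and
    \<open>J\<close>.\<close>
  proof (rule uniformly_perfectI_small_radii[OF compact_Y, of "1 / 2" h])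
    fix p r assume p: "p \<in> mspace Y" and r: "0 < r" "r \<le> h"
    obtain u k where u: "p = (u, k)" "u \<in> mspace B" "k \<in> mspace K"
      using p by (auto simp: Y_def)
    obtain y where y: "y \<in> mspace K" "r / 2 \<le> mdist K k y" "mdist K k y \<le> r"
      using K(5) u(3) r by blast
    have "mdist Y (u, k) (u, y) = mdist K k y"
      using isometric_embedding_Pair_left[OF u(2), of K] u(3) y(1)
      unfolding isometric_embedding_def Y_def by blast
    then show "\<exists>q\<in>mspace Y. 1 / 2 * r \<le> mdist Y p q \<and> mdist Y p q \<le> r"
      using u y by (intro bexI[of _ "(u, y)"]) (simp_all add: Y_def del: mdist_prod_metric)
  qed (use \<open>h > 0\<close> in auto)
  moreover have "gh_close e X Y"
  proof (rule gh_closeI[where P = "\<lambda>x p. mdist X (fst (fst p)) x \<le> h"])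
    fix x assume "x \<in> mspace X"
    then obtain a where a: "a \<in> A" "mdist X a x \<le> h"
      using A(4) by blast
    then show "\<exists>p\<in>mspace Y. mdist X (fst (fst p)) x \<le> h"
      using k0 t by (intro bexI[of _ "((a, 0), k0)"]) (simp_all add: Y_def B_def XA J)
  next
    fix p assume p: "p \<in> mspace Y"
    then have "fst (fst p) \<in> mspace X"
      using A(3) by (auto simp: Y_def B_def XA)
    moreover from this have "mdist X (fst (fst p)) (fst (fst p)) = 0"
      by simp
    ultimately show "\<exists>x\<in>mspace X. mdist X (fst (fst p)) x \<le> h"
      using \<open>h > 0\<close> by (intro bexI[of _ "fst (fst p)"]) simp_all
  next
    fix x p x' p'
    assume x: "x \<in> mspace X" and p: "p \<in> mspace Y" "mdist X (fst (fst p)) x \<le> h"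
      and x': "x' \<in> mspace X" and p': "p' \<in> mspace Y" "mdist X (fst (fst p')) x' \<le> h"
    have B: "fst p \<in> mspace B" "fst p' \<in> mspace B" "snd p \<in> mspace K" "snd p' \<in> mspace K"
      using p(1) p'(1) by (auto simp: Y_def)
    then have J': "snd (fst p) \<in> {0..t}" "snd (fst p') \<in> {0..t}"
      and A': "fst (fst p) \<in> mspace X" "fst (fst p') \<in> mspace X"
      using A(3) by (auto simp: B_def XA J)
    have "mdist X (fst (fst p)) (fst (fst p')) \<le> mdist B (fst p) (fst p')"
      and "mdist B (fst p) (fst p') \<le> mdist X (fst (fst p)) (fst (fst p')) + dist (snd (fst p)) (snd (fst p'))"
      using mdist_prod_metric_bounds(1,3)[of "fst p" XA J "fst p'"] B unfolding B_def XA J by blast+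
    moreover have "mdist B (fst p) (fst p') \<le> mdist Y p p'"
      and "mdist Y p p' \<le> mdist B (fst p) (fst p') + mdist K (snd p) (snd p')"
      using mdist_prod_metric_bounds(1,3)[of p B K p'] p(1) p'(1) unfolding Y_def by blast+
    moreover have "mdist K (snd p) (snd p') \<le> h"
      using K(4) B by blast
    moreover have "dist (snd (fst p)) (snd (fst p')) \<le> h"
      using J' t by (auto simp: dist_real_def abs_le_iff)
    moreover have "mdist X x x' \<le> mdist X (fst (fst p)) x + mdist X (fst (fst p)) (fst (fst p')) + mdist X (fst (fst p')) x'"
      using mdist_triangle[OF x A'(1) x'] mdist_triangle[OF A' x'] mdist_commute[of X x "fst (fst p)"] by linarith
    moreover have "mdist X (fst (fst p)) (fst (fst p')) \<le> mdist X (fst (fst p)) x + mdist X x x' + mdist X (fst (fst p')) x'"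
      using mdist_triangle[OF A'(1) x A'(2)] mdist_triangle[OF x x' A'(2)] mdist_commute[of X x' "fst (fst p')"] by linarith
    ultimately have "mdist X x x' - mdist Y p p' \<le> 2 * h" "mdist Y p p' - mdist X x x' \<le> 4 * h"
      using p(2) p'(2) by linarith+
    then show "\<bar>mdist X x x' - mdist Y p p'\<bar> \<le> 2 * e"
      using \<open>h > 0\<close> by (simp add: h_def abs_le_iff)
  qed
  ultimately show ?thesis
    using compact_Y by blast
qed

text \<open>The new point is placed at height \<open>h\<close> above \<open>y0\<close> inside the
  product of \<open>Y\<close> with a two-point space. \<open>Y\<close> embeds into the result and
  the result into the product, so doubling and uniform disconnectedness transfer both ways.\<close>

lemma ex_isolated_extension:
  fixes Y :: "'a metric"
  assumes Y: "nonempty_compact_metric Y" and "h > 0"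
  shows "\<exists>Z :: ('a \<times> real) metric. nonempty_compact_metric Z \<and> gh_close h Y Z \<and>
    doubling Z = doubling Y \<and> uniformly_disconnected Z = uniformly_disconnected Y \<and> \<not> uniformly_perfect Z"
proof -
  obtain y0 where y0: "y0 \<in> mspace Y"
    using Y by (auto simp: nonempty_compact_metric_def)
  define T :: "real metric" where "T = submetric euclidean_metric {0, h}"
  define W where "W = prod_metric Y T"
  define S where "S = mspace Y \<times> {0} \<union> {(y0, h)}"
  define Z where "Z = submetric W S"
  have T: "mspace T = {0, h}" "mdist T = dist"
    by (auto simp: T_def)
  have S: "S \<subseteq> mspace W"
    using y0 by (auto simp: S_def W_def T)
  have Z: "mspace Z = S" "mdist Z = mdist W"
    using S by (auto simp: Z_def)
  have finite_T: "finite (mspace T)"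
    by (simp add: T)
  have "compactin (mtopology_of W) (mspace Y \<times> {0})"
    using Y finite_imp_compactin[of "{0}" "mtopology_of T"]
    by (simp add: W_def mtopology_of_prod_metric compactin_Times nonempty_compact_metric_def compact_space_def T)
  moreover have "compactin (mtopology_of W) {(y0, h)}"
    using S by (intro finite_imp_compactin) (auto simp: S_def)
  ultimately have "compactin (mtopology_of W) S"
    unfolding S_def by (rule compactin_Un)
  then have compact_Z: "nonempty_compact_metric Z"
    unfolding Z_def by (rule nonempty_compact_metric_submetric) (simp add: S_def)
  have emb_Z: "isometric_embedding Z W (\<lambda>x. x)"
    unfolding Z_def by (rule isometric_embedding_submetric)
  have "isometric_embedding Y W (\<lambda>y. (y, 0))"
    unfolding W_def by (rule isometric_embedding_Pair_right) (simp add: T)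
  then have emb_Y: "isometric_embedding Y Z (\<lambda>y. (y, 0))"
    by (auto simp: isometric_embedding_def Z S_def)
  have "doubling Z = doubling Y"
  proof
    show "doubling Y" if "doubling Z"
      by (rule doubling_embedding[OF emb_Y that])
    assume "doubling Y"
    then have "doubling W"
      unfolding W_def by (rule doubling_prod[OF _ doubling_finite[OF finite_T]])
    then show "doubling Z"
      by (rule doubling_embedding[OF emb_Z])
  qed
  moreover have "uniformly_disconnected Z = uniformly_disconnected Y"
  proof
    show "uniformly_disconnected Y" if "uniformly_disconnected Z"
      by (rule uniformly_disconnected_embedding[OF emb_Y that])
    assume "uniformly_disconnected Y"
    then have "uniformly_disconnected W"
      unfolding W_def by (rule uniformly_disconnected_prod[OF _ uniformly_disconnected_finite[OF finite_T]])
    then show "uniformly_disconnected Z"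
      by (rule uniformly_disconnected_embedding[OF emb_Z])
  qed
  moreover have "\<not> uniformly_perfect Z"
  proof (rule not_uniformly_perfect_isolated[OF compact_Z, of "(y0, h)" "(y0, 0)" h])
    fix z assume z: "z \<in> mspace Z" "z \<noteq> (y0, h)"
    then have "snd z = 0" "z \<in> mspace W" "(y0, h) \<in> mspace W"
      using S by (auto simp: Z S_def)
    then have "dist h 0 \<le> mdist W (y0, h) z"
      using mdist_prod_metric_bounds(2)[of "(y0, h)" Y T z] by (simp add: W_def T del: mdist_prod_metric)
    then show "h \<le> mdist Z (y0, h) z"
      using \<open>h > 0\<close> by (simp add: Z)
  qed (use y0 \<open>h > 0\<close> in \<open>auto simp: Z S_def\<close>)
  moreover have "gh_close h Y Z"
  proof (rule gh_closeI[where P = "\<lambda>y z. y = fst z"])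
    show "\<exists>z\<in>mspace Z. y = fst z" if "y \<in> mspace Y" for y
      using that by (intro bexI[of _ "(y, 0)"]) (auto simp: Z S_def)
    show "\<exists>y\<in>mspace Y. y = fst z" if "z \<in> mspace Z" for z
      using that y0 by (auto simp: Z S_def)
  next
    fix y z y' z' assume z: "z \<in> mspace Z" "y = fst z" "z' \<in> mspace Z" "y' = fst z'"
    then have W: "z \<in> mspace W" "z' \<in> mspace W"
      using S by (auto simp: Z)
    have "snd z \<in> {0, h}" "snd z' \<in> {0, h}"
      using z by (auto simp: Z S_def)
    then have "dist (snd z) (snd z') \<le> h"
      using \<open>h > 0\<close> by (auto simp: dist_real_def)
    moreover have "mdist Y y y' \<le> mdist Z z z'" "mdist Z z z' \<le> mdist Y y y' + dist (snd z) (snd z')"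
      using mdist_prod_metric_bounds(1,3)[of z Y T z'] W z unfolding Z W_def T by blast+
    ultimately show "\<bar>mdist Y y y' - mdist Z z z'\<bar> \<le> 2 * h"
      using \<open>h > 0\<close> by linarith
  qed
  ultimately show ?thesis
    using compact_Z by blast
qed

section \<open>Return to the quotient, and density\<close>

lemma isometric_doubling: "isometric X Y \<Longrightarrow> doubling X = doubling Y"
  using isometric_doubling_with[of X Y] isometric_doubling_with[OF isometric_sym, of X Y]
  unfolding doubling_def by blast

lemma isometric_uniformly_disconnected:
  "isometric X Y \<Longrightarrow> uniformly_disconnected X = uniformly_disconnected Y"
  using isometric_uniformly_disconnected_with[of X Y] isometric_uniformly_disconnected_with[OF isometric_sym, of X Y]
  unfolding uniformly_disconnected_def by blast

lemma isometric_uniformly_perfect: "isometric X Y \<Longrightarrow> uniformly_perfect X = uniformly_perfect Y"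
  using isometric_uniformly_perfect_with[of X Y] isometric_uniformly_perfect_with[OF isometric_sym, of X Y]
  unfolding uniformly_perfect_def by blast

text \<open>The approximations live on product types. A compact metric space has an isometric copy
  on the reals, which represents a point of the quotient with the same properties.\<close>

lemma ex_gh_space_near:
  fixes Y :: "'a metric"
  assumes Y: "nonempty_compact_metric Y" "gh_close e (rep_gh_space X) Y" and "0 < e" "e < r"
  shows "\<exists>Z. gh_dist X Z < r \<and> gh_doubling Z = doubling Y \<and>
    gh_uniformly_disconnected Z = uniformly_disconnected Y \<and> gh_uniformly_perfect Z = uniformly_perfect Y"
proof -
  obtain M :: "real metric" where M: "isometric Y M"
    using nonempty_compact_metric_isometric_real[OF Y(1)] by blast
  define Z where "Z = abs_gh_space M"
  have "isometric (rep_gh_space Z) M"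
    unfolding Z_def by (rule isometric_rep_abs_gh_space[OF isometric_nonempty_compact_metric[OF M Y(1)]])
  then have iso: "isometric Y (rep_gh_space Z)"
    using isometric_trans[OF M isometric_sym] by blast
  have "gh_close e (rep_gh_space X) (rep_gh_space Z)"
    by (rule gh_close_cong[OF Y(2) isometric_refl iso])
  then have "gh_dist X Z < r"
    unfolding gh_dist_less_iff using assms(3,4) by blast
  then show ?thesis
    using isometric_doubling[OF iso] isometric_uniformly_disconnected[OF iso] isometric_uniformly_perfect[OF iso]
    by (intro exI[of _ Z]) (simp add: gh_doubling.rep_eq gh_uniformly_disconnected.rep_eq gh_uniformly_perfect.rep_eq)
qed

lemma ex_gh_space_near_with_properties:
  assumes "r > 0"
  shows "\<exists>Z. gh_dist X Z < r \<and> gh_doubling Z = b1 \<and> gh_uniformly_disconnected Z = b2 \<and> gh_uniformly_perfect Z = b3"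
proof -
  \<comment> \<open>Two approximation stages of size \<open>r / 4\<close> stay strictly within
    \<open>r\<close>.\<close>
  have e: "0 < r / 4"
    using assms by simp
  obtain Y :: "((real \<times> real) \<times> (nat \<Rightarrow> bool)) metric" where Y: "nonempty_compact_metric Y"
    "gh_close (r / 4) (rep_gh_space X) Y" "doubling Y = b1" "uniformly_disconnected Y = b2" "uniformly_perfect Y"
    using ex_uniformly_perfect_approximation[OF rep_gh_space_compact e, of X b1 b2] by blast
  show ?thesis
  proof (cases b3)
    case True
    then show ?thesis
      using ex_gh_space_near[OF Y(1,2), of r] Y(3-5) assms by simp
  next
    case False
    obtain Y' :: "(((real \<times> real) \<times> (nat \<Rightarrow> bool)) \<times> real) metric" where Y': "nonempty_compact_metric Y'"
      "gh_close (r / 4) Y Y'" "doubling Y' = doubling Y"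
      "uniformly_disconnected Y' = uniformly_disconnected Y" "\<not> uniformly_perfect Y'"
      using ex_isolated_extension[OF Y(1) e] by blast
    show ?thesis
      using ex_gh_space_near[OF Y'(1) gh_close_trans[OF Y(2) Y'(2)], of r] Y(3,4) Y'(3-5) False assms by simp
  qed
qed

lemma dense_in_\<X>: "dense_in gh_topology (\<X> u v w)"
proof -
  have "\<exists>Y\<in>\<X> u v w. Y \<in> T" if T: "openin gh_topology T" "X \<in> T" for X T
  proof -
    obtain r where r: "r > 0" "\<forall>Y. gh_dist X Y < r \<longrightarrow> Y \<in> T"
      using T unfolding openin_gh_topology by blast
    \<comment> \<open>The index 2 imposes no condition and may be treated like 1, so one pattern of
      truth values covers all indices.\<close>
    obtain Z where Z: "gh_dist X Z < r" "gh_doubling Z = (u \<noteq> 0)"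
      "gh_uniformly_disconnected Z = (v \<noteq> 0)" "gh_uniformly_perfect Z = (w \<noteq> 0)"
      using ex_gh_space_near_with_properties[OF r(1)] by blast
    have "Z \<in> \<X> u v w"
      using Z(2-4) by (simp add: \<X>_def selected_def \<Q>\<^sub>1_def \<Q>\<^sub>2_def \<Q>\<^sub>3_def)
    then show ?thesis
      using r(2) Z(1) by blast
  qed
  then have "X \<in> gh_topology closure_of \<X> u v w" for X
    unfolding in_closure_of topspace_gh_topology by blast
  then show ?thesis
    unfolding dense_in_def by auto
qed

theorem theorem1p2:
  fixes u v w :: nat
  assumes "u \<in> {0, 1, 2}" and "v \<in> {0, 1, 2}" and "w \<in> {0, 1, 2}"
  shows "({u, v, w} - {2} = {1} \<longrightarrow>
            dense_in gh_topology (\<X> u v w) \<and> fsigma_in gh_topology (\<X> u v w)) \<and>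
         ({u, v, w} - {2} = {0} \<longrightarrow>
            dense_in gh_topology (\<X> u v w) \<and> gdelta_in gh_topology (\<X> u v w)) \<and>
         ({u, v, w} - {2} = {0, 1} \<longrightarrow>
            dense_in gh_topology (\<X> u v w) \<and>
            fsigma_delta_in gh_topology (\<X> u v w) \<and>
            gdelta_sigma_in gh_topology (\<X> u v w))"
proof -
  note fsigma = fsigma_in_doubling fsigma_in_uniformly_disconnected fsigma_in_uniformly_perfect
  have UNIV: "fsigma_in gh_topology UNIV" "gdelta_in gh_topology UNIV"
    using fsigma_in_topspace[of gh_topology] gdelta_in_topspace[of gh_topology] by simp_all
  have selected_fsigma: "fsigma_in gh_topology (selected Q k)" if "fsigma_in gh_topology Q" "k \<noteq> 0" for Q k
    using that UNIV by (simp add: selected_def)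
  have selected_gdelta: "gdelta_in gh_topology (selected Q k)" if "fsigma_in gh_topology Q" "k \<noteq> 1" for Q k
  proof -
    have "gdelta_in gh_topology (UNIV - Q)"
      using that(1) fsigma_in_gdelta_in[of gh_topology Q] by simp
    then show ?thesis
      using that(2) UNIV(2) by (simp add: selected_def)
  qed
  have \<X>_fsigma: "fsigma_in gh_topology (\<X> u v w)" if "u \<noteq> 0" "v \<noteq> 0" "w \<noteq> 0" for u v w
    unfolding \<X>_def using that by (intro fsigma_in_Int selected_fsigma fsigma)
  have \<X>_gdelta: "gdelta_in gh_topology (\<X> u v w)" if "u \<noteq> 1" "v \<noteq> 1" "w \<noteq> 1" for u v w
    unfolding \<X>_def using that by (intro gdelta_in_Int selected_gdelta fsigma)
  \<comment> \<open>\<open>p\<close> discards the negative conditions and \<open>q\<close> the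
    positive ones by turning them into 2. The set is thus the intersection of an F_sigma part and a
    G_delta part.\<close>
  define p where "p k = (if k = 0 then 2 else k)" for k :: nat
  define q where "q k = (if k = 1 then 2 else k)" for k :: nat
  have "selected Q k = selected Q (p k) \<inter> selected Q (q k)" for Q k
    by (auto simp: selected_def p_def q_def)
  then have eq: "\<X> u v w = \<X> (p u) (p v) (p w) \<inter> \<X> (q u) (q v) (q w)"
    unfolding \<X>_def by blast
  have F: "fsigma_in gh_topology (\<X> (p u) (p v) (p w))"
    by (rule \<X>_fsigma) (auto simp: p_def)
  have G: "gdelta_in gh_topology (\<X> (q u) (q v) (q w))"
    by (rule \<X>_gdelta) (auto simp: q_def)
  have Fd: "fsigma_delta_in gh_topology (\<X> u v w)"
    unfolding eq by (rule fsigma_delta_in_Int[OF F G open_imp_fsigma_in_gh])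
  have Gs: "gdelta_sigma_in gh_topology (\<X> u v w)"
    unfolding eq by (rule gdelta_sigma_in_Int[OF F G closed_imp_gdelta_in_gh])
  show ?thesis
  proof (intro conjI impI dense_in_\<X> Fd Gs)
    assume eq: "{u, v, w} - {2} = {1}"
    have "k \<noteq> 0" if "k \<in> {u, v, w}" for k
    proof
      assume "k = 0"
      then have "0 \<in> {u, v, w} - {2}"
        using that by simp
      then show False
        unfolding eq by simp
    qed
    then show "fsigma_in gh_topology (\<X> u v w)"
      by (intro \<X>_fsigma) simp_all
  next
    assume eq: "{u, v, w} - {2} = {0}"
    have "k \<noteq> 1" if "k \<in> {u, v, w}" for k
    proof
      assume "k = 1"
      then have "1 \<in> {u, v, w} - {2}"
        using that by simp
      then show False
        unfolding eq by simp
    qed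
    then show "gdelta_in gh_topology (\<X> u v w)"
      by (intro \<X>_gdelta) simp_all
  qed
qed

end
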